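(* Let $p\ge 4$ and $n\ge \max\{3p-1,\,p+8\}$ be integers, and let $3\le r_1<r_2<\dots<r_{p-1}\le n-p$ be odd integers. Let $\mathcal{L}$ be an $n$-dimensional non-split $p$-filiform complex Leibniz algebra whose associated naturally graded algebra $\operatorname{gr}\mathcal{L}$ is isomorphic to $L(n,r_1,r_2,\dots,r_{p-1})$ or to $Q(n,r_1,r_2,\dots,r_{p-1})$. Then $\mathcal{L}$ does not admit a gradation of maximum length.
   Context: All algebras are finite-dimensional over $\mathbb{C}$ and non-split, i.e. not a direct sum of two nonzero two-sided ideals. A (right) Leibniz algebra is an algebra $(\mathcal{L},[-,-])$ satisfying $[x,[y,z]]=[[x,y],z]-[[x,z],y]$ for all $x,y,z$. Its descending central sequence is $\mathcal{L}^1=\mathcal{L}$, $\mathcal{L}^{k+1}=[\mathcal{L}^k,\mathcal{L}]$; $\mathcal{L}$ is nilpotent with nilindex $s$ if $\mathcal{L}^s\ne 0$ and $\mathcal{L}^{s+1}=0$. Let $\mathcal{L}$ be nilpotent. For $x\in\mathcal{L}\setminus\mathcal{L}^2$ let $R_x(y)=[y,x]$ and let $C(x)$ be the non-increasing sequence of sizes of the Jordan blocks of the nilpotent operator $R_x$. The characteristic sequence $C(\mathcal{L})$ is the lexicographic maximum of $C(x)$ over $x\in\mathcal{L}\setminus\mathcal{L}^2$. An $n$-dimensional nilpotent Leibniz algebra is $p$-filiform ($0\le p<n$) if $C(\mathcal{L})=(n-p,1,\dots,1)$ with $p$ ones. The associated naturally graded algebra is $\operatorname{gr}\mathcal{L}=\bigoplus_{i=1}^{s}\mathcal{L}^i/\mathcal{L}^{i+1}$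 with the induced product. A $\mathbb{Z}$-gradation $\mathcal{L}=\bigoplus_{i\in\mathbb{Z}}V_i$, $[V_i,V_j]\subseteq V_{i+j}$ for all $i,j$, with finitely many nonzero $V_i$, is connected if $\mathcal{L}=V_{k}\oplus V_{k+1}\oplus\dots\oplus V_{k+t}$ for some $k\in\mathbb{Z}$, $t\ge 0$, with $V_{k+i}\neq 0$ for all $0\le i\le t$; its length is $t+1$. A gradation of maximum length is a connected gradation of length $\dim\mathcal{L}$ (so every $V_{k+i}$ is one-dimensional). The $n$-dimensional Lie algebras below have basis $\{x_0,x_1,\dots,x_{n-p},y_1,\dots,y_{p-1}\}$; brackets not obtained from the listed ones by antisymmetry are zero. $L(n,r_1,\dots,r_{p-1})$: $[x_0,x_i]=x_{i+1}$ for $1\le i\le n-p-1$; $[x_i,x_{r_j-i}]=(-1)^{i-1}y_j$ for $1\le i\le \frac{r_j-1}{2}$, $1\le j\le p-1$. $Q(n,r_1,\dots,r_{p-1})$ (for $n-p$ odd and $r_{p-1}\le n-p-2$): $[x_0,x_i]=x_{i+1}$ for $1\le i\le n-p-1$; $[x_i,x_{r_j-i}]=(-1)^{i-1}y_j$ for $1\le i\le \frac{r_j-1}{2}$, $1\le j\le p-1$; $[x_i,x_{n-p-i}]=(-1)^{i-1}x_{n-p}$ for $1\le i\le\frac{n-p-1}{2}$. *)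

theory Defs
  imports Complex_Main "Jordan_Normal_Form.Jordan_Normal_Form"
begin

record 'v calg = "'v partial_object" +
  vadd :: "'v \<Rightarrow> 'v \<Rightarrow> 'v"
  vscale :: "complex \<Rightarrow> 'v \<Rightarrow> 'v"
  vbr :: "'v \<Rightarrow> 'v \<Rightarrow> 'v"

definition calg_isomorphic :: "'u calg \<Rightarrow> 'v calg \<Rightarrow> bool" where
  "calg_isomorphic A B \<longleftrightarrow> (\<exists>\<phi>. bij_betw \<phi> (carrier A) (carrier B) \<and>
     (\<forall>u\<in>carrier A. \<forall>v\<in>carrier A. \<phi> (vadd A u v) = vadd B (\<phi> u) (\<phi> v)) \<and>
     (\<forall>c. \<forall>u\<in>carrier A. \<phi> (vscale A c u) = vscale B c (\<phi> u)) \<and>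
     (\<forall>u\<in>carrier A. \<forall>v\<in>carrier A. \<phi> (vbr A u v) = vbr B (\<phi> u) (\<phi> v)))"


locale leibniz_algebra = vector_space scale
  for scale :: "complex \<Rightarrow> 'a::ab_group_add \<Rightarrow> 'a" +
  fixes br :: "'a \<Rightarrow> 'a \<Rightarrow> 'a"
  assumes finite_dim: "\<exists>B. finite B \<and> span B = UNIV"
    and br_linear_right: "\<And>x. Vector_Spaces.linear scale scale (\<lambda>y. br x y)"
    and br_linear_left: "\<And>y. Vector_Spaces.linear scale scale (\<lambda>x. br x y)"
    and leibniz: "\<And>x y z. br x (br y z) = br (br x y) z - br (br x z) y"
begin

definition two_sided_ideal :: "'a set \<Rightarrow> bool" where
  "two_sided_ideal I \<longleftrightarrow> subspace I \<and> (\<forall>x\<in>I. \<forall>y. br x y \<in> I \<and> br y x \<in> I)"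

definition non_split :: bool where
  "non_split \<longleftrightarrow> \<not> (\<exists>I J. two_sided_ideal I \<and> two_sided_ideal J \<and> I \<noteq> {0} \<and> J \<noteq> {0} \<and>
     I \<inter> J = {0} \<and> {x + y | x y. x \<in> I \<and> y \<in> J} = UNIV)"

text \<open>The sequence is indexed from 1; the value at 0 is a dummy.\<close>

fun lcs :: "nat \<Rightarrow> 'a set" where
  "lcs 0 = UNIV"
| "lcs (Suc 0) = UNIV"
| "lcs (Suc (Suc k)) = span {br x y | x y. x \<in> lcs (Suc k)}"

definition has_nilindex :: "nat \<Rightarrow> bool" where
  "has_nilindex s \<longleftrightarrow> 1 \<le> s \<and> lcs s \<noteq> {0} \<and> lcs (Suc s) = {0}"

definition nilpotent :: bool where
  "nilpotent \<longleftrightarrow> (\<exists>s. has_nilindex s)"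

definition nilindex :: nat where
  "nilindex = (THE s. has_nilindex s)"

definition op_matrix :: "'a list \<Rightarrow> ('a \<Rightarrow> 'a) \<Rightarrow> complex mat" where
  "op_matrix bs f = mat (length bs) (length bs)
     (\<lambda>(i, j). representation (set bs) (f (bs ! j)) (bs ! i))"

definition jordan_sizes :: "('a \<Rightarrow> 'a) \<Rightarrow> nat list \<Rightarrow> bool" where
  "jordan_sizes f ks \<longleftrightarrow> sorted_wrt (\<ge>) ks \<and>
     (\<exists>bs n_as. distinct bs \<and> independent (set bs) \<and> span (set bs) = UNIV \<and>
        jordan_nf (op_matrix bs f) n_as \<and> ks = map fst n_as)"

definition is_char_seq :: "nat list \<Rightarrow> bool" where
  "is_char_seq ks \<longleftrightarrow>
     (\<exists>x. x \<notin> lcs 2 \<and> jordan_sizes (\<lambda>y. br y x) ks) \<and>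
     (\<forall>x ks'. x \<notin> lcs 2 \<and> jordan_sizes (\<lambda>y. br y x) ks' \<longrightarrow>
        ks' = ks \<or> (ks', ks) \<in> lexord less_than)"

definition p_filiform :: "nat \<Rightarrow> bool" where
  "p_filiform p \<longleftrightarrow> nilpotent \<and> p < dim UNIV \<and>
     is_char_seq ((dim UNIV - p) # replicate p 1)"

definition quot :: "'a set \<Rightarrow> 'a set \<Rightarrow> 'a set set" where
  "quot V W = (\<lambda>v. (+) v ` W) ` V"

text \<open>An element of the associated graded algebra is a family of cosets, the i-th one
  in the quotient of \<open>lcs i\<close> by \<open>lcs (Suc i)\<close>. The operations are the induced ones, written
  as sets of all values obtained from representatives; adding \<open>lcs (Suc k)\<close> makes the result
  a full coset (relevant for the scalar 0 and for the product).\<close>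

definition gr :: "(nat \<Rightarrow> 'a set) calg" where
  "gr = \<lparr>carrier = (\<Pi>\<^sub>E i\<in>{1..nilindex}. quot (lcs i) (lcs (Suc i))),
     vadd = (\<lambda>F G. \<lambda>k\<in>{1..nilindex}. {a + b | a b. a \<in> F k \<and> b \<in> G k}),
     vscale = (\<lambda>c F. \<lambda>k\<in>{1..nilindex}. {scale c a + w | a w. a \<in> F k \<and> w \<in> lcs (Suc k)}),
     vbr = (\<lambda>F G. \<lambda>k\<in>{1..nilindex}.
        {(\<Sum>i = 1..<k. br (a i) (b (k - i))) + w | a b w.
           (\<forall>i\<in>{1..<k}. a i \<in> F i \<and> b i \<in> G i) \<and> w \<in> lcs (Suc k)})\<rparr>"

definition gradation :: "(int \<Rightarrow> 'a set) \<Rightarrow> bool" where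
  "gradation V \<longleftrightarrow> (\<forall>i. subspace (V i)) \<and> finite {i. V i \<noteq> {0}} \<and>
     (\<forall>x. \<exists>!f. (\<forall>i. f i \<in> V i) \<and> x = (\<Sum>i | V i \<noteq> {0}. f i)) \<and>
     (\<forall>i j. \<forall>x\<in>V i. \<forall>y\<in>V j. br x y \<in> V (i + j))"

definition connected_gradation :: "(int \<Rightarrow> 'a set) \<Rightarrow> nat \<Rightarrow> bool" where
  "connected_gradation V l \<longleftrightarrow> gradation V \<and>
     (\<exists>k t. {i. V i \<noteq> {0}} = {k..k + int t} \<and> l = t + 1)"

definition max_length_gradation :: "(int \<Rightarrow> 'a set) \<Rightarrow> bool" where
  "max_length_gradation V \<longleftrightarrow> connected_gradation V (dim UNIV)"

end


datatype idx = X nat | Y nat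

definition idxs :: "nat \<Rightarrow> nat \<Rightarrow> idx set" where
  "idxs n p = X ` {0..n - p} \<union> Y ` {1..p - 1}"

text \<open>\<open>L_table n p r a b z\<close> is the coefficient of the basis vector \<open>z\<close> in the listed bracket of
  the basis vectors \<open>a\<close> and \<open>b\<close>, and 0 if that bracket is not listed; similarly \<open>Q_table\<close>.
  No table lists both \<open>(a, b)\<close> and \<open>(b, a)\<close>, so the antisymmetric completion is the difference
  taken in \<open>table_algebra\<close>.\<close>

fun L_table :: "nat \<Rightarrow> nat \<Rightarrow> (nat \<Rightarrow> nat) \<Rightarrow> idx \<Rightarrow> idx \<Rightarrow> idx \<Rightarrow> complex" where
  "L_table n p r (X i) (X k) z =
     of_bool (i = 0 \<and> 1 \<le> k \<and> k \<le> n - p - 1 \<and> z = X (k + 1)) +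
     (\<Sum>j = 1..p - 1.
        if 1 \<le> i \<and> i \<le> (r j - 1) div 2 \<and> i + k = r j \<and> z = Y j then (-1) ^ (i - 1) else 0)"
| "L_table n p r _ _ z = 0"

fun Q_table :: "nat \<Rightarrow> nat \<Rightarrow> (nat \<Rightarrow> nat) \<Rightarrow> idx \<Rightarrow> idx \<Rightarrow> idx \<Rightarrow> complex" where
  "Q_table n p r (X i) (X k) z = L_table n p r (X i) (X k) z +
     (if 1 \<le> i \<and> i \<le> (n - p - 1) div 2 \<and> i + k = n - p \<and> z = X (n - p)
      then (-1) ^ (i - 1) else 0)"
| "Q_table n p r _ _ z = 0"

definition table_algebra :: "idx set \<Rightarrow> (idx \<Rightarrow> idx \<Rightarrow> idx \<Rightarrow> complex) \<Rightarrow> (idx \<Rightarrow> complex) calg" where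
  "table_algebra B T = \<lparr>carrier = {u. \<forall>z. z \<notin> B \<longrightarrow> u z = 0},
     vadd = (\<lambda>u v z. u z + v z),
     vscale = (\<lambda>c u z. c * u z),
     vbr = (\<lambda>u v z. \<Sum>a\<in>B. \<Sum>b\<in>B. u a * v b * (T a b z - T b a z))\<rparr>"

definition L_algebra :: "nat \<Rightarrow> nat \<Rightarrow> (nat \<Rightarrow> nat) \<Rightarrow> (idx \<Rightarrow> complex) calg" where
  "L_algebra n p r = table_algebra (idxs n p) (L_table n p r)"

definition Q_algebra :: "nat \<Rightarrow> nat \<Rightarrow> (nat \<Rightarrow> nat) \<Rightarrow> (idx \<Rightarrow> complex) calg" where
  "Q_algebra n p r = table_algebra (idxs n p) (Q_table n p r)"

end

theory Submission
  imports Defs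
begin

text \<open>
  A gradation of maximum length gives two homogeneous elements of degrees \<open>a \<noteq> b\<close> that are
  independent modulo \<open>lcs 2\<close>. Left-normed words in them are homogeneous, and whether such a word of
  length \<open>i\<close> lies in \<open>lcs (Suc i)\<close> can be read off from the model of the graded algebra. Homogeneous
  elements of equal degree are proportional, so a degree determines the depth in the lower central
  series. If both symbols involve \<open>X 0\<close>, every word with distinct first two letters survives, which
  gives more degrees than the dimension. Otherwise the degrees are \<open>a\<close>, an arithmetic progression
  \<open>b + i a\<close> and the numbers \<open>2 b + (\<rho> - 2) a\<close> with \<open>\<rho>\<close> odd. Since they fill an interval,
  \<open>\<bar>a\<bar> = 1\<close>, and then at least four odd numbers have to fit around the block
  \<open>b + i a\<close>, whereas an interval leaves room for one on each side.
\<close>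

section \<open>Degree sets\<close>

text \<open>The length of the interval forces a = 1 or a = -1. The progression is then a block of N
  consecutive integers and all other degrees are odd, so at most one integer fits on either side of
  the block. That leaves room for N + 2 degrees, against at least N + 4.\<close>

lemma interval_not_degree_set:
  fixes a b k :: int and N :: nat and R :: "nat set"
  assumes N: "8 \<le> N" and R3: "3 \<le> card R" and R2: "2 * card R \<le> N + 2"
    and odd: "\<And>\<rho>. \<rho> \<in> R \<Longrightarrow> odd \<rho>"
    and D: "{k..<k + int (N + 1 + card R)} =
      insert a ((\<lambda>i. b + int i * a) ` {..<N} \<union> (\<lambda>\<rho>. 2 * b + (int \<rho> - 2) * a) ` R)"
  shows False
proof -
  define n where "n = N + 1 + card R"
  have blk: "b + int i * a \<in> {k..<k + int n}" if "i < N" for i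
    using that unfolding n_def D by blast
  have b0: "k \<le> b" "b < k + int n" using blk[of 0] N by auto
  have b1: "k \<le> b + int (N - 1) * a" "b + int (N - 1) * a < k + int n" using blk[of "N - 1"] N by auto
  have rng: "\<bar>int (N - 1) * a\<bar> < int n" using b0 b1 by linarith
  \<comment> \<open>If |a| >= 2, then 2(N - 1) < N + 1 + card R <= 3N/2 + 2, which means N <
    8.\<close>
  have a1: "\<bar>a\<bar> \<le> 1"
  proof (rule ccontr)
    assume "\<not> \<bar>a\<bar> \<le> 1"
    then have "int (N - 1) * 2 \<le> int (N - 1) * \<bar>a\<bar>" by (intro mult_left_mono) auto
    also have "\<dots> = \<bar>int (N - 1) * a\<bar>" by (simp add: abs_mult)
    finally show False using rng N R2 unfolding n_def by linarith
  qed
  have a0: "a \<noteq> 0"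
  proof
    assume "a = 0"
    then have "{k..<k + int n} \<subseteq> {0, b, 2 * b}" unfolding n_def D by auto
    then have "card {k..<k + int n} \<le> card {0, b, 2 * b}" by (intro card_mono) auto
    also have "\<dots> \<le> 3" by (simp add: card_insert_if)
    finally show False using N by (simp add: n_def)
  qed
  \<comment> \<open>The least element of the block, whichever sign a has.\<close>
  define lo where "lo = min b (b + int (N - 1) * a)"
  have aa: "a = 1 \<or> a = -1" using a1 a0 by linarith
  \<comment> \<open>Here a is odd and 2b + (\<rho> - 2)a has the parity of \<rho>. Two neighbouring
    integers are never both odd, which yields the bounds \<open>lo1\<close> and
    \<open>hi1\<close>.\<close>
  have outside: "odd d" if d: "d \<in> {k..<k + int n}" "d < lo \<or> lo + int N \<le> d" for d
  proof -
    have nblk: "d \<noteq> b + int i * a" if "i < N" for i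
      using aa d(2) that unfolding lo_def by (auto simp: min_def split: if_splits)
    have "d = a \<or> (\<exists>\<rho>\<in>R. d = 2 * b + (int \<rho> - 2) * a)"
      using d(1) nblk unfolding n_def D by blast
    then show "odd d" using aa odd by auto
  qed
  have lo1: "lo \<le> k + 1"
  proof (rule ccontr)
    assume "\<not> lo \<le> k + 1"
    then have "odd k" "odd (k + 1)" using outside[of k] outside[of "k + 1"] N by (auto simp: n_def)
    then show False by simp
  qed
  have hi1: "k + int n \<le> lo + int N + 1"
  proof (rule ccontr)
    assume "\<not> ?thesis"
    then have "odd (lo + int N)" "odd (lo + int N + 1)"
      using outside[of "lo + int N"] outside[of "lo + int N + 1"] b0 b1 N
      by (auto simp: n_def lo_def min_def split: if_splits)
    then show False by simp
  qed
  show False using lo1 hi1 R3 by (simp add: n_def)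
qed

text \<open>\<open>H d l\<close> is to mean that degree d contains an element of exact depth l in
  the lower central series. As the degree fixes the depth, no two of the listed degrees can
  coincide, so by counting they exhaust the interval.\<close>

lemma no_level_function:
  fixes a b k :: int and N :: nat and R :: "nat set" and H :: "int \<Rightarrow> nat \<Rightarrow> bool"
  assumes fin: "finite R" and N: "8 \<le> N" and R3: "3 \<le> card R" and R2: "2 * card R \<le> N + 2"
    and odd: "\<And>\<rho>. \<rho> \<in> R \<Longrightarrow> odd \<rho> \<and> 3 \<le> \<rho>"
    and H_range: "\<And>i l. H i l \<Longrightarrow> i \<in> {k..<k + int (N + 1 + card R)}"
    and H_fun: "\<And>i l l'. H i l \<Longrightarrow> H i l' \<Longrightarrow> l = l'"
    and ab: "a \<noteq> b" and Ha: "H a 1"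
    and Hx: "\<And>i. i < N \<Longrightarrow> H (b + int i * a) (Suc i)"
    and Hy: "\<And>\<rho>. \<rho> \<in> R \<Longrightarrow> H (2 * b + (int \<rho> - 2) * a) \<rho>"
  shows False
proof -
  let ?x = "\<lambda>i. b + int i * a" and ?y = "\<lambda>\<rho>. 2 * b + (int \<rho> - 2) * a"
  have ix: "inj_on ?x {..<N}"
    by (intro inj_onI) (metis H_fun Hx lessThan_iff nat.inject)
  have iy: "inj_on ?y R"
    by (intro inj_onI) (metis H_fun Hy)
  have dxy: "?x i \<noteq> ?y \<rho>" if "i < N" "\<rho> \<in> R" for i \<rho>
  proof
    assume eq: "?x i = ?y \<rho>"
    \<comment> \<open>Equal depths give i = \<rho> - 1, and b + (\<rho> - 1)a = 2b + (\<rho> - 2)a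
      amounts to a = b.\<close>
    then have "\<rho> = Suc i" using H_fun[OF Hx[OF that(1)]] Hy[OF that(2)] by metis
    with eq show False using ab by (simp add: algebra_simps)
  qed
  have dx: "a \<noteq> ?x i" if "i < N" for i
  proof
    assume eq: "a = ?x i"
    then have "Suc i = 1" using H_fun[OF Hx[OF that]] Ha by metis
    with eq ab show False by simp
  qed
  have dy: "a \<noteq> ?y \<rho>" if "\<rho> \<in> R" for \<rho>
  proof
    assume eq: "a = ?y \<rho>"
    then have "\<rho> = 1" using H_fun[OF Hy[OF that]] Ha by metis
    with odd[OF that] show False by simp
  qed
  let ?S = "insert a (?x ` {..<N} \<union> ?y ` R)"
  have "card (?x ` {..<N} \<union> ?y ` R) = N + card R"
    using dxy fin by (subst card_Un_disjoint) (auto simp: card_image ix iy)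
  moreover have "a \<notin> ?x ` {..<N} \<union> ?y ` R" using dx dy by blast
  ultimately have "card ?S = N + 1 + card R" using fin by simp
  moreover have "?S \<subseteq> {k..<k + int (N + 1 + card R)}"
    using H_range[OF Ha] H_range[OF Hx] H_range[OF Hy] by blast
  ultimately have "?S = {k..<k + int (N + 1 + card R)}"
    by (intro card_subset_eq) auto
  then show False using interval_not_degree_set[OF N R3 R2, of k a b] odd by simp
qed

text \<open>Equal degrees have equal depths, hence equal s + t, and then a \<noteq> b gives s = s'.
  Every pair (s, t) thus costs a degree of its own, too many for the interval.\<close>

lemma no_two_parameter_levels:
  fixes a b k :: int and N n :: nat and H :: "int \<Rightarrow> nat \<Rightarrow> bool"
  assumes N: "8 \<le> N" and n: "2 * n \<le> 3 * N + 4"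
    and H_range: "\<And>i l. H i l \<Longrightarrow> i \<in> {k..<k + int n}"
    and H_fun: "\<And>i l l'. H i l \<Longrightarrow> H i l' \<Longrightarrow> l = l'"
    and ab: "a \<noteq> b"
    and Hw: "\<And>s t. s + t + 2 \<le> N \<Longrightarrow> H (int (s + 1) * a + int (t + 1) * b) (s + t + 2)"
  shows False
proof -
  let ?w = "\<lambda>(s, t). int (s + 1) * a + int (t + 1) * b"
  \<comment> \<open>Three values of t and s <= N - 4 keep s + t + 2 <= N. This gives 3(N - 3)
    degrees, and 3(N - 3) <= n <= (3N + 4)/2 fails for N >= 8.\<close>
  let ?P = "{..N - 4} \<times> {..2::nat}"
  have inP: "s + t + 2 \<le> N" if "(s, t) \<in> ?P" for s t using that N by auto
  have "inj_on ?w ?P"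
  proof (intro inj_onI, clarsimp, goal_cases)
    case (1 s t s' t')
    have "H (int (s' + 1) * a + int (t' + 1) * b) (s + t + 2)"
      using Hw[of s t] inP[of s t] 1 by (simp add: algebra_simps)
    then have "s + t + 2 = s' + t' + 2"
      using H_fun[OF _ Hw[of s' t']] inP[of s' t'] 1 by simp
    then have t: "int t = int s' + int t' - int s" by linarith
    have "(int s - int s') * (a - b) = 0" using 1 by (simp add: t algebra_simps)
    then show ?case using ab t by simp
  qed
  then have "card (?w ` ?P) = (N - 3) * 3" using N by (simp add: card_image)
  moreover have "?w ` ?P \<subseteq> {k..<k + int n}"
    using H_range[OF Hw[OF inP]] by auto
  then have "card (?w ` ?P) \<le> card {k..<k + int n}" by (intro card_mono) auto
  ultimately show False using N n by simp
qed

section \<open>The model algebras\<close>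

text \<open>\<open>L\<close> is the case \<open>N = n - p\<close>, \<open>R = {r\<^sub>1, \<dots>, r\<^bsub>p-1\<^esub>}\<close>. For \<open>Q\<close> the vector \<open>x\<^bsub>n-p\<^esub>\<close> is treated like the
  \<open>y\<^sub>j\<close>: there \<open>N = n - p - 1\<close> and \<open>R\<close> also contains \<open>n - p\<close>.\<close>

locale antisym_model =
  fixes A :: "(idx \<Rightarrow> complex) calg" and N :: nat and R :: "nat set"
  assumes vadd_model: "vadd A u v = (\<lambda>z. u z + v z)"
    and vscale_model: "vscale A c u = (\<lambda>z. c * u z)"
    and vbr_self: "vbr A u u = (\<lambda>z. 0)"
    and vbr_nonzero: "\<exists>u\<in>carrier A. \<exists>v\<in>carrier A. vbr A u v \<noteq> (\<lambda>z. 0)"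
    and vbr_X0: "vbr A u v (X 0) = 0"
    and vbr_X1: "vbr A u v (X 1) = 0"
    and vbr_X: "1 \<le> k \<Longrightarrow> k < N \<Longrightarrow> vbr A u v (X (Suc k)) = u (X 0) * v (X k) - u (X k) * v (X 0)"
    and vbr_R: "\<rho> \<in> R \<Longrightarrow> (\<And>i. Suc i < \<rho> \<Longrightarrow> u (X i) = 0) \<Longrightarrow> v (X 0) = 0 \<Longrightarrow>
      u (X (\<rho> - 1)) * v (X 1) \<noteq> 0 \<Longrightarrow> vbr A u v \<noteq> (\<lambda>z. 0)"
    and derived_model: "z \<in> carrier A \<Longrightarrow> z (X 0) = 0 \<Longrightarrow> z (X 1) = 0 \<Longrightarrow>
      \<exists>s\<in>carrier A. \<exists>t\<in>carrier A. \<exists>s'\<in>carrier A. \<exists>t'\<in>carrier A. z = vadd A (vbr A s t) (vbr A s' t')"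

section \<open>Coordinates of brackets in the table algebras\<close>

definition alt_sum :: "nat \<Rightarrow> (idx \<Rightarrow> complex) \<Rightarrow> (idx \<Rightarrow> complex) \<Rightarrow> complex" where
  "alt_sum \<rho> u v = (\<Sum>i = 1..(\<rho> - 1) div 2. (-1) ^ (i - 1) * u (X i) * v (X (\<rho> - i)))"

lemma alt_sum_eq_0_left:
  assumes "\<And>i. i \<le> (\<rho> - 1) div 2 \<Longrightarrow> 1 \<le> i \<Longrightarrow> u (X i) = 0"
  shows "alt_sum \<rho> u v = 0"
  unfolding alt_sum_def using assms by (intro sum.neutral) auto

lemma alt_sum_leading:
  assumes "3 \<le> \<rho>" and "\<And>i. 2 \<le> i \<Longrightarrow> i \<le> (\<rho> - 1) div 2 \<Longrightarrow> u (X i) * v (X (\<rho> - i)) = 0"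
  shows "alt_sum \<rho> u v = u (X 1) * v (X (\<rho> - 1))"
proof -
  have "alt_sum \<rho> u v = (\<Sum>i\<in>{1}. (-1) ^ (i - 1) * u (X i) * v (X (\<rho> - i)))"
    unfolding alt_sum_def using assms by (intro sum.mono_neutral_right) (auto simp: mult.assoc)
  then show ?thesis by simp
qed

text \<open>For fixed i the condition i + k = \<rho> leaves the single index k = \<rho> - i, which
  is in range because \<rho> <= m.\<close>

lemma alt_sum_graph:
  assumes "\<rho> \<le> m"
  shows "(\<Sum>i\<le>m. \<Sum>k\<le>m. u (X i) * v (X k) *
      (if 1 \<le> i \<and> i \<le> (\<rho> - 1) div 2 \<and> i + k = \<rho> then (-1) ^ (i - 1) else 0)) = alt_sum \<rho> u v"
proof -
  have "(\<Sum>k\<le>m. u (X i) * v (X k) *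
      (if 1 \<le> i \<and> i \<le> (\<rho> - 1) div 2 \<and> i + k = \<rho> then (-1) ^ (i - 1) else 0)) =
      (if i \<in> {1..(\<rho> - 1) div 2} then (-1) ^ (i - 1) * u (X i) * v (X (\<rho> - i)) else 0)" (is "?S = _") for i
  proof (cases "i \<in> {1..(\<rho> - 1) div 2}")
    case True
    then have "?S = (\<Sum>k\<le>m. if k = \<rho> - i then (-1) ^ (i - 1) * u (X i) * v (X (\<rho> - i)) else 0)"
      by (intro sum.cong) auto
    also have "\<dots> = (-1) ^ (i - 1) * u (X i) * v (X (\<rho> - i))" using assms by simp
    finally show ?thesis using True by simp
  qed (intro trans[OF sum.neutral], auto)
  then have "(\<Sum>i\<le>m. \<Sum>k\<le>m. u (X i) * v (X k) *
      (if 1 \<le> i \<and> i \<le> (\<rho> - 1) div 2 \<and> i + k = \<rho> then (-1) ^ (i - 1) else 0)) =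
      (\<Sum>i\<le>m. if i \<in> {1..(\<rho> - 1) div 2} then (-1) ^ (i - 1) * u (X i) * v (X (\<rho> - i)) else 0)"
    by simp
  also have "\<dots> = alt_sum \<rho> u v"
    unfolding alt_sum_def using assms by (subst sum.inter_restrict[symmetric]) (auto intro!: sum.cong)
  finally show ?thesis .
qed

text \<open>The bilinear form of the listed brackets before antisymmetrisation. Summing over
  X-indices is enough because the tables vanish on every pair involving some Y.\<close>

definition table_form :: "nat \<Rightarrow> (idx \<Rightarrow> idx \<Rightarrow> idx \<Rightarrow> complex) \<Rightarrow> (idx \<Rightarrow> complex) \<Rightarrow> (idx \<Rightarrow> complex) \<Rightarrow> idx \<Rightarrow> complex" where
  "table_form m T u v z = (\<Sum>i\<le>m. \<Sum>k\<le>m. u (X i) * v (X k) * T (X i) (X k) z)"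

lemma vbr_table_algebra:
  assumes "\<And>a b z. (\<nexists>i k. a = X i \<and> b = X k) \<Longrightarrow> T a b z = 0"
  shows "vbr (table_algebra (idxs n p) T) u v z = table_form (n - p) T u v z - table_form (n - p) T v u z"
proof -
  let ?B = "idxs n p" and ?f = "\<lambda>a b. u a * v b * (T a b z - T b a z)"
  have X: "X ` {..n - p} \<subseteq> ?B" "finite ?B" by (auto simp: idxs_def)
  have zero: "?f a b = 0" if "a \<in> ?B - X ` {..n - p} \<or> b \<in> ?B - X ` {..n - p}" for a b
    using that assms[of a b z] assms[of b a z] by (auto simp: idxs_def)
  have "vbr (table_algebra ?B T) u v z = (\<Sum>a\<in>?B. \<Sum>b\<in>?B. ?f a b)"
    by (simp add: table_algebra_def)
  also have "\<dots> = (\<Sum>a\<in>X ` {..n - p}. \<Sum>b\<in>?B. ?f a b)"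
    using X zero by (intro sum.mono_neutral_right) (auto intro!: sum.neutral)
  also have "\<dots> = (\<Sum>a\<in>X ` {..n - p}. \<Sum>b\<in>X ` {..n - p}. ?f a b)"
    using X zero by (intro sum.cong refl sum.mono_neutral_right) auto
  also have "\<dots> = (\<Sum>i\<le>n - p. \<Sum>k\<le>n - p. ?f (X i) (X k))"
    by (simp add: sum.reindex inj_on_def)
  also have "\<dots> = table_form (n - p) T u v z - (\<Sum>i\<le>n - p. \<Sum>k\<le>n - p. u (X i) * v (X k) * T (X k) (X i) z)"
    unfolding table_form_def by (simp add: right_diff_distrib sum_subtractf)
  also have "(\<Sum>i\<le>n - p. \<Sum>k\<le>n - p. u (X i) * v (X k) * T (X k) (X i) z) = table_form (n - p) T v u z"
    unfolding table_form_def by (subst sum.swap) (simp add: mult.commute[of "u _"])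
  finally show ?thesis .
qed

lemma L_table_not_X: "(\<nexists>i k. a = X i \<and> b = X k) \<Longrightarrow> L_table n p r a b z = 0"
  by (cases "(n, p, r, a, b, z)" rule: L_table.cases) auto

lemma Q_table_not_X: "(\<nexists>i k. a = X i \<and> b = X k) \<Longrightarrow> Q_table n p r a b z = 0"
  by (cases "(n, p, r, a, b, z)" rule: Q_table.cases) auto

lemma table_form_L_X:
  assumes "p < n"
  shows "table_form (n - p) (L_table n p r) u v (X l) =
    (if 2 \<le> l \<and> l \<le> n - p then u (X 0) * v (X (l - 1)) else 0)"
proof -
  have *: "L_table n p r (X i) (X k) (X l) =
      (if i = 0 then if k = l - 1 then if 2 \<le> l \<and> l \<le> n - p then 1 else 0 else 0 else 0)" for i k
    using assms by auto
  let ?c = "if 2 \<le> l \<and> l \<le> n - p then u (X 0) * v (X (l - 1)) else 0"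
  have "table_form (n - p) (L_table n p r) u v (X l) =
      (\<Sum>i\<le>n - p. \<Sum>k\<le>n - p. if i = 0 then if k = l - 1 then ?c else 0 else 0)"
    unfolding table_form_def * by (intro sum.cong refl) simp
  also have "\<dots> = (\<Sum>i\<le>n - p. if i = 0 then \<Sum>k\<le>n - p. if k = l - 1 then ?c else 0 else 0)"
    by (intro sum.cong refl) simp
  also have "\<dots> = ?c" by auto
  finally show ?thesis .
qed

lemma table_form_L_Y:
  assumes "j \<in> {1..p - 1} \<Longrightarrow> r j \<le> n - p"
  shows "table_form (n - p) (L_table n p r) u v (Y j) = (if j \<in> {1..p - 1} then alt_sum (r j) u v else 0)"
proof -
  have *: "L_table n p r (X i) (X k) (Y j) = (if j \<in> {1..p - 1} then
      if 1 \<le> i \<and> i \<le> (r j - 1) div 2 \<and> i + k = r j then (-1) ^ (i - 1) else 0 else 0)" for i k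
  proof -
    have "L_table n p r (X i) (X k) (Y j) = (\<Sum>j'\<in>{1..p - 1}.
        if 1 \<le> i \<and> i \<le> (r j' - 1) div 2 \<and> i + k = r j' \<and> Y j = Y j' then (-1) ^ (i - 1) else 0)"
      by simp
    also have "\<dots> = (\<Sum>j'\<in>{1..p - 1}. if j' = j then
      if 1 \<le> i \<and> i \<le> (r j - 1) div 2 \<and> i + k = r j then (-1) ^ (i - 1) else 0 else 0)"
      by (intro sum.cong refl) auto
    finally show ?thesis by (subst (asm) sum.delta) auto
  qed
  show ?thesis
    using alt_sum_graph[of "r j" "n - p" u v] assms
    unfolding table_form_def * by (cases "j \<in> {1..p - 1}") (simp_all del: atLeastAtMost_iff)
qed

lemma table_form_Q:
  "table_form (n - p) (Q_table n p r) u v z =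
    table_form (n - p) (L_table n p r) u v z + (if z = X (n - p) then alt_sum (n - p) u v else 0)"
proof -
  have "table_form (n - p) (Q_table n p r) u v z = table_form (n - p) (L_table n p r) u v z +
      (\<Sum>i\<le>n - p. \<Sum>k\<le>n - p. u (X i) * v (X k) *
        (if 1 \<le> i \<and> i \<le> (n - p - 1) div 2 \<and> i + k = n - p \<and> z = X (n - p) then (-1) ^ (i - 1) else 0))"
    unfolding table_form_def by (simp only: Q_table.simps distrib_left sum.distrib)
  then show ?thesis using alt_sum_graph[of "n - p" "n - p" u v] by (cases "z = X (n - p)") simp_all
qed


text \<open>The flag \<open>q\<close> separates Q from L. For Q the coordinate X m of a bracket
  carries an alternating sum besides the shift term, so the pure shift formula ends one index
  earlier and m joins the odd numbers in R.\<close>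

lemma table_algebra_model:
  fixes n p :: nat and r :: "nat \<Rightarrow> nat" and q :: bool
  defines "m \<equiv> n - p"
  assumes T0: "\<And>a b z. (\<nexists>i k. a = X i \<and> b = X k) \<Longrightarrow> T a b z = 0"
    and T: "\<And>u v z. table_form m T u v z =
      table_form m (L_table n p r) u v z + (if q \<and> z = X m then alt_sum m u v else 0)"
    and m: "4 \<le> m"
    and r: "\<And>j. j \<in> {1..p - 1} \<Longrightarrow> 3 \<le> r j \<and> r j \<le> (if q then m - 2 else m)"
    and inj: "inj_on r {1..p - 1}"
  shows "antisym_model (table_algebra (idxs n p) T) (if q then m - 1 else m)
    (r ` {1..p - 1} \<union> (if q then {m} else {}))" (is "antisym_model ?A ?N ?R")
proof -
  have pn: "p < n" using m by (simp add: m_def)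
  have r': "r j \<le> n - p" if "j \<in> {1..p - 1}" for j using r[OF that] by (auto simp: m_def split: if_splits)
  have br: "vbr ?A u v z = table_form m T u v z - table_form m T v u z" for u v z
    unfolding m_def by (rule vbr_table_algebra[OF T0])
  have brX: "vbr ?A u v (X l) = (if 2 \<le> l \<and> l \<le> m then u (X 0) * v (X (l - 1)) - u (X (l - 1)) * v (X 0) else 0) +
      (if q \<and> l = m then alt_sum m u v - alt_sum m v u else 0)" for u v l
    unfolding br T by (simp add: table_form_L_X[OF pn, folded m_def])
  have brY: "vbr ?A u v (Y j) = (if j \<in> {1..p - 1} then alt_sum (r j) u v - alt_sum (r j) v u else 0)" for u v j
    using table_form_L_Y[of j p r n, folded m_def] r'[of j] unfolding br T by (simp add: m_def)
  have va: "vadd ?A u v = (\<lambda>z. u z + v z)" for u v by (simp add: table_algebra_def)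
  have car: "u \<in> carrier ?A \<longleftrightarrow> (\<forall>l>m. u (X l) = 0) \<and> (\<forall>j. j \<notin> {1..p - 1} \<longrightarrow> u (Y j) = 0)" for u
  proof -
    have "(\<forall>z. z \<notin> idxs n p \<longrightarrow> u z = 0) \<longleftrightarrow>
        (\<forall>l. X l \<notin> idxs n p \<longrightarrow> u (X l) = 0) \<and> (\<forall>j. Y j \<notin> idxs n p \<longrightarrow> u (Y j) = 0)"
      by (metis idx.exhaust)
    moreover have "X l \<in> idxs n p \<longleftrightarrow> l \<le> m" "Y l \<in> idxs n p \<longleftrightarrow> l \<in> {1..p - 1}" for l
      by (auto simp: idxs_def m_def)
    ultimately show ?thesis by (simp add: table_algebra_def not_le)
  qed
  define e0 e1 :: "idx \<Rightarrow> complex" where "e0 = (\<lambda>z. of_bool (z = X 0))" and "e1 = (\<lambda>z. of_bool (z = X 1))"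
  have e: "e0 \<in> carrier ?A" "e1 \<in> carrier ?A" using m by (auto simp: car e0_def e1_def)
  \<comment> \<open>If u starts at index \<rho> - 1, the first sum vanishes since (\<rho> - 1)/2 <
    \<rho> - 1, and in the second the terms with i >= 2 vanish.\<close>
  have lead: "alt_sum \<rho> u v - alt_sum \<rho> v u = - (v (X 1) * u (X (\<rho> - 1)))"
    if "3 \<le> \<rho>" "\<And>i. Suc i < \<rho> \<Longrightarrow> u (X i) = 0" for \<rho> u v
  proof -
    have "alt_sum \<rho> u v = 0" using that by (intro alt_sum_eq_0_left that(2)) auto
    moreover have "alt_sum \<rho> v u = v (X 1) * u (X (\<rho> - 1))"
      using that by (intro alt_sum_leading) auto
    ultimately show ?thesis by simp
  qed
  show ?thesis
  proof
    show "vadd ?A u v = (\<lambda>z. u z + v z)" "vscale ?A c u = (\<lambda>z. c * u z)" for u v c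
      by (simp_all add: table_algebra_def)
    show "vbr ?A u u = (\<lambda>z. 0)" for u by (simp add: br fun_eq_iff)
    have "vbr ?A e0 e1 (X 2) \<noteq> 0" unfolding brX using m by (simp add: e0_def e1_def)
    then show "\<exists>u\<in>carrier ?A. \<exists>v\<in>carrier ?A. vbr ?A u v \<noteq> (\<lambda>z. 0)" using e by metis
    show "vbr ?A u v (X 0) = 0" "vbr ?A u v (X 1) = 0" for u v using m by (simp_all add: brX)
    show "vbr ?A u v (X (Suc k)) = u (X 0) * v (X k) - u (X k) * v (X 0)" if "1 \<le> k" "k < ?N" for u v k
      using that by (auto simp: brX split: if_splits)
    show "vbr ?A u v \<noteq> (\<lambda>z. 0)"
      if \<rho>: "\<rho> \<in> ?R" and u: "\<And>i. Suc i < \<rho> \<Longrightarrow> u (X i) = 0" and v: "v (X 0) = 0"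
        and nz: "u (X (\<rho> - 1)) * v (X 1) \<noteq> 0" for \<rho> u v
    proof -
      consider j where "j \<in> {1..p - 1}" "\<rho> = r j" | "q" "\<rho> = m" using \<rho> by (auto split: if_splits)
      then have "\<exists>z. vbr ?A u v z \<noteq> 0"
      proof cases
        case 1
        then have "vbr ?A u v (Y j) = - (v (X 1) * u (X (\<rho> - 1)))"
          using lead[of \<rho> u v] u r[OF 1(1)] by (simp add: brY)
        then show ?thesis using nz by (intro exI[of _ "Y j"]) auto
      next
        case 2
        \<comment> \<open>The shift terms in coordinate X m drop out because both u and v vanish at
          X 0.\<close>
        then have "vbr ?A u v (X m) = - (v (X 1) * u (X (\<rho> - 1)))"
          using lead[of \<rho> u v] u[of 0] u m v by (simp add: brX)
        then show ?thesis using nz by (intro exI[of _ "X m"]) auto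
      qed
      then show ?thesis by auto
    qed
    show "\<exists>s\<in>carrier ?A. \<exists>t\<in>carrier ?A. \<exists>s'\<in>carrier ?A. \<exists>t'\<in>carrier ?A.
        z = vadd ?A (vbr ?A s t) (vbr ?A s' t')"
      if z: "z \<in> carrier ?A" "z (X 0) = 0" "z (X 1) = 0" for z
    proof -
      \<comment> \<open>The decomposition is z = [e0, t] + [e1, t']. Here \<open>t\<close> moves the
        X-coordinates of z down by one index, and bracketing with e0 moves them back;
        \<open>t'\<close> stores z (Y j) at index r j - 1, from where e1 sends it to Y j.\<close>
      define t where "t = (\<lambda>w. case w of X k \<Rightarrow> if 1 \<le> k then z (X (Suc k)) else 0 | Y j \<Rightarrow> 0)"
      define t' where "t' = (\<lambda>w. case w of X k \<Rightarrow> \<Sum>j\<in>{1..p - 1}. if r j = Suc k then z (Y j) else 0 | Y j \<Rightarrow> 0)"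
      have t'0: "t' (X k) = 0" if "\<And>j. j \<in> {1..p - 1} \<Longrightarrow> r j \<noteq> Suc k" for k
        unfolding t'_def using that by (auto intro!: sum.neutral)
      have t'r: "t' (X (r j - 1)) = z (Y j)" if j: "j \<in> {1..p - 1}" for j
      proof -
        have "t' (X (r j - 1)) = (\<Sum>j'\<in>{1..p - 1}. if j' = j then z (Y j) else 0)"
          unfolding t'_def idx.case using r[OF j] j by (intro sum.cong refl) (auto dest: inj_onD[OF inj])
        then show ?thesis using j by simp
      qed
      have "t \<in> carrier ?A" using z by (auto simp: car t_def)
      moreover have "t' \<in> carrier ?A"
      proof -
        have "t' (X l) = 0" if "m < l" for l
          using r' that by (intro t'0) (fastforce simp: m_def)
        then show ?thesis unfolding car by (simp add: t'_def)
      qed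
      moreover have "z = vadd ?A (vbr ?A e0 t) (vbr ?A e1 t')"
      proof
        fix w
        have a0: "alt_sum \<rho> e0 t = 0" for \<rho> by (intro alt_sum_eq_0_left) (simp add: e0_def)
        have a1: "alt_sum \<rho> t e0 = 0" for \<rho> 
          unfolding alt_sum_def e0_def by (intro sum.neutral) auto
        have a2: "alt_sum \<rho> t' e1 = 0" if "3 \<le> \<rho>" for \<rho>
          unfolding alt_sum_def e1_def using that by (intro sum.neutral) auto
        have a3: "alt_sum \<rho> e1 t' = t' (X (\<rho> - 1))" if "3 \<le> \<rho>" for \<rho>
          using that by (subst alt_sum_leading) (auto simp: e1_def)
        show "z w = vadd ?A (vbr ?A e0 t) (vbr ?A e1 t') w"
        proof (cases w)
          case (X l)
          \<comment> \<open>In Q, [e1, t'] must not touch the coordinate X m. It would do so through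
            some r j = m, which r j <= m - 2 excludes.\<close>
          have "q \<Longrightarrow> t' (X (m - 1)) = 0" using r m by (intro t'0) fastforce
          moreover have "t' (X 0) = 0" using r by (intro t'0) fastforce
          moreover have "e1 (X 0) = 0" "e0 (X 0) = 1" "t (X 0) = 0" by (simp_all add: e1_def e0_def t_def)
          moreover have "z (X l) = (if 2 \<le> l \<and> l \<le> m then t (X (l - 1)) else 0)"
          proof -
            consider "l = 0" | "l = 1" | "l > m" | "2 \<le> l" "l \<le> m" by linarith
            then show ?thesis using z by cases (auto simp: car t_def)
          qed
          ultimately show ?thesis unfolding X using m
            by (simp add: va brX a0 a1 a2 a3)
        next
          case (Y j)
          show ?thesis
          proof (cases "j \<in> {1..p - 1}")
            case True
            then show ?thesis unfolding Y using r[OF True] t'r[OF True]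
              by (simp add: va brY a0 a1 a2 a3)
          next
            case False
            then show ?thesis unfolding Y using z(1)
              by (auto simp: va brY car)
          qed
        qed
      qed
      ultimately show ?thesis using e by blast
    qed
  qed
qed

section \<open>The associated graded algebra\<close>

context leibniz_algebra
begin

section \<open>The lower central series\<close>

lemma br_add_left: "br (x + y) z = br x z + br y z"
  and br_scale_left: "br (scale c x) z = scale c (br x z)"
  and br_add_right: "br z (x + y) = br z x + br z y"
  and br_scale_right: "br z (scale c x) = scale c (br z x)"
  using br_linear_left[of z] br_linear_right[of z] by (auto simp: Vector_Spaces.linear_iff)

lemma br_0_left [simp]: "br 0 z = 0" and br_0_right [simp]: "br z 0 = 0"
  using br_scale_left[of 0 0 z] br_scale_right[of z 0 0] by simp_all

lemma subspace_lcs: "subspace (lcs k)"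
  by (induction k rule: lcs.induct) auto

lemma br_in_lcs_Suc: "1 \<le> i \<Longrightarrow> x \<in> lcs i \<Longrightarrow> br x y \<in> lcs (Suc i)"
  by (cases i) (auto intro: span_base)

lemma lcs_Suc_subset: "lcs (Suc k) \<subseteq> lcs k"
proof (induction k rule: lcs.induct)
  case (3 k)
  then show ?case by (auto intro!: span_mono)
qed auto

lemma lcs_antimono: "k \<le> l \<Longrightarrow> lcs l \<subseteq> lcs k"
  using lcs_Suc_subset by (rule lift_Suc_antimono_le)

text \<open>Induction on j with i free: in [x,[u,v]] = [[x,u],v] - [[x,v],u] the first term uses the
  hypothesis at i and the second at i + 1.\<close>

lemma br_in_lcs_add:
  assumes "1 \<le> i" "1 \<le> j" "x \<in> lcs i" "y \<in> lcs j"
  shows "br x y \<in> lcs (i + j)"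
  using assms
proof (induction j arbitrary: i x y rule: lcs.induct)
  case 1
  then show ?case by simp
next
  case 2
  then show ?case using br_in_lcs_Suc by simp
next
  case (3 j)
  from 3(5) have "y \<in> span {br u v |u v. u \<in> lcs (Suc j)}" by simp
  then show ?case
  proof (induction rule: span_induct_alt)
    case base
    then show ?case using subspace_0[OF subspace_lcs] by (simp del: lcs.simps)
  next
    case (step c w y)
    then obtain u v where w: "w = br u v" "u \<in> lcs (Suc j)" by blast
    have "br (br x u) v \<in> lcs (Suc (i + Suc j))"
      using 3 w by (intro br_in_lcs_Suc "3.IH") auto
    moreover have "br (br x v) u \<in> lcs (Suc i + Suc j)"
      using 3 w by (intro "3.IH" br_in_lcs_Suc) auto
    ultimately have "br x w \<in> lcs (i + Suc (Suc j))"
      unfolding w leibniz by (intro subspace_diff[OF subspace_lcs]) auto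
    then show ?case unfolding br_add_right br_scale_right
      by (intro subspace_add[OF subspace_lcs] subspace_scale[OF subspace_lcs] step)
  qed
qed

lemma lcs_stable:
  assumes "1 \<le> k" "lcs (Suc k) = lcs k" "k \<le> l"
  shows "lcs l = lcs k"
  using assms(3)
proof (induction l rule: dec_induct)
  case (step l)
  obtain k' l' where "k = Suc k'" "l = Suc l'" using assms(1) step(1) by (cases k; cases l) auto
  then show ?case using step assms(2) by simp
qed simp

lemma lcs_stable_eq_0:
  assumes "nilpotent" "1 \<le> k" "lcs (Suc k) = lcs k"
  shows "lcs k = {0}"
proof -
  obtain s where "lcs (Suc s) = {0}" using assms(1) by (auto simp: nilpotent_def has_nilindex_def)
  then have "lcs (max k (Suc s)) \<subseteq> {0}" using lcs_antimono[of "Suc s" "max k (Suc s)"] by simp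
  then show ?thesis using lcs_stable[OF assms(2,3), of "max k (Suc s)"] subspace_0[OF subspace_lcs] by auto
qed

lemma has_nilindex_nilindex:
  assumes "nilpotent"
  shows "has_nilindex nilindex"
proof -
  obtain s where s: "has_nilindex s" using assms by (auto simp: nilpotent_def)
  have "t \<le> s" if "has_nilindex s" "has_nilindex t" for s t
  proof (rule ccontr)
    assume "\<not> t \<le> s"
    then have "lcs t \<subseteq> lcs (Suc s)" by (intro lcs_antimono) simp
    then show False using that subspace_0[OF subspace_lcs, of t] by (auto simp: has_nilindex_def)
  qed
  then have "\<exists>!s. has_nilindex s" using s by (blast intro: le_antisym)
  then show ?thesis unfolding nilindex_def by (rule theI')
qed

lemma lcs_beyond_nilindex:
  assumes "nilpotent" "nilindex < k"
  shows "lcs k = {0}"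
  using lcs_antimono[of "Suc nilindex" k] has_nilindex_nilindex[OF assms(1)] assms(2)
    subspace_0[OF subspace_lcs, of k] by (auto simp: has_nilindex_def)

text \<open>Elements of \<open>gr\<close> are handled through representatives;
  \<open>carrier_gr_E\<close> shows that all elements arise in this way.\<close>

definition coset_family :: "(nat \<Rightarrow> 'a) \<Rightarrow> nat \<Rightarrow> 'a set" where
  "coset_family a = (\<lambda>k\<in>{1..nilindex}. (+) (a k) ` lcs (Suc k))"

lemma coset_eq_iff: "(+) x ` lcs k = (+) y ` lcs k \<longleftrightarrow> x - y \<in> lcs k"
proof
  assume "(+) x ` lcs k = (+) y ` lcs k"
  moreover have "x \<in> (+) x ` lcs k" using subspace_0[OF subspace_lcs] by force
  ultimately show "x - y \<in> lcs k" by auto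
next
  have *: "(+) x ` lcs k \<subseteq> (+) y ` lcs k" if "x - y \<in> lcs k" for x y
  proof
    fix z assume "z \<in> (+) x ` lcs k"
    then obtain w where "z = x + w" "w \<in> lcs k" by auto
    then have "z = y + ((x - y) + w)" "(x - y) + w \<in> lcs k"
      using that subspace_add[OF subspace_lcs] by auto
    then show "z \<in> (+) y ` lcs k" by blast
  qed
  assume d: "x - y \<in> lcs k"
  then have "y - x \<in> lcs k" using subspace_neg[OF subspace_lcs, of "x - y"] by simp
  then show "(+) x ` lcs k = (+) y ` lcs k" using * d by blast
qed

lemma coset_family_eq_iff: "coset_family a = coset_family b \<longleftrightarrow> (\<forall>k\<in>{1..nilindex}. a k - b k \<in> lcs (Suc k))"
proof
  assume eq: "coset_family a = coset_family b"
  show "\<forall>k\<in>{1..nilindex}. a k - b k \<in> lcs (Suc k)"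
  proof
    fix k assume "k \<in> {1..nilindex}"
    then show "a k - b k \<in> lcs (Suc k)"
      using fun_cong[OF eq, of k] unfolding coset_family_def by (simp only: restrict_apply' coset_eq_iff)
  qed
next
  assume "\<forall>k\<in>{1..nilindex}. a k - b k \<in> lcs (Suc k)"
  then show "coset_family a = coset_family b"
    unfolding coset_family_def coset_eq_iff[symmetric] by (intro restrict_ext) blast
qed

lemma coset_family_carrier: "(\<And>k. k \<in> {1..nilindex} \<Longrightarrow> a k \<in> lcs k) \<Longrightarrow> coset_family a \<in> carrier gr"
  by (auto simp: gr_def coset_family_def quot_def)

lemma carrier_gr_E:
  assumes "F \<in> carrier gr"
  obtains a where "F = coset_family a" "\<And>k. k \<in> {1..nilindex} \<Longrightarrow> a k \<in> lcs k"
proof -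
  have "\<forall>k\<in>{1..nilindex}. \<exists>x\<in>lcs k. F k = (+) x ` lcs (Suc k)"
    using assms by (auto simp: gr_def quot_def dest!: PiE_mem)
  then obtain a where a: "\<And>k. k \<in> {1..nilindex} \<Longrightarrow> a k \<in> lcs k \<and> F k = (+) (a k) ` lcs (Suc k)"
    by metis
  have "F = coset_family a"
    using assms a by (auto simp: gr_def coset_family_def fun_eq_iff restrict_def PiE_def extensional_def)
  then show thesis using a that by blast
qed

lemma set_plus_lcs: "{a + b |a b. a \<in> (+) x ` lcs k \<and> b \<in> (+) y ` lcs k} = (+) (x + y) ` lcs k"
proof (intro Set.set_eqI iffI)
  fix z assume "z \<in> {a + b |a b. a \<in> (+) x ` lcs k \<and> b \<in> (+) y ` lcs k}"
  then obtain v w where "z = (x + y) + (v + w)" "v \<in> lcs k" "w \<in> lcs k" by (auto simp: algebra_simps)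
  then show "z \<in> (+) (x + y) ` lcs k" using subspace_add[OF subspace_lcs] by blast
next
  fix z assume "z \<in> (+) (x + y) ` lcs k"
  then obtain w where w: "z = (x + 0) + (y + w)" "w \<in> lcs k" by (auto simp: algebra_simps)
  then show "z \<in> {a + b |a b. a \<in> (+) x ` lcs k \<and> b \<in> (+) y ` lcs k}"
    using subspace_0[OF subspace_lcs] by blast
qed

lemma vadd_coset_family: "vadd gr (coset_family a) (coset_family b) = coset_family (\<lambda>k. a k + b k)"
  unfolding gr_def coset_family_def calg.simps
  by (intro restrict_ext) (simp only: restrict_apply' set_plus_lcs)

lemma vscale_coset_family: "vscale gr c (coset_family a) = coset_family (\<lambda>k. scale c (a k))"
proof -
  have "{scale c x + w |x w. x \<in> (+) y ` lcs k \<and> w \<in> lcs k} = (+) (scale c y) ` lcs k" for y k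
  proof (intro Set.set_eqI iffI)
    fix z assume "z \<in> {scale c x + w |x w. x \<in> (+) y ` lcs k \<and> w \<in> lcs k}"
    then obtain v w where "z = scale c y + (scale c v + w)" "v \<in> lcs k" "w \<in> lcs k"
      by (auto simp: algebra_simps scale_right_distrib)
    then show "z \<in> (+) (scale c y) ` lcs k"
      using subspace_add[OF subspace_lcs] subspace_scale[OF subspace_lcs] by blast
  next
    fix z assume "z \<in> (+) (scale c y) ` lcs k"
    then obtain w where w: "z = scale c (y + 0) + w" "w \<in> lcs k" by auto
    then show "z \<in> {scale c x + w |x w. x \<in> (+) y ` lcs k \<and> w \<in> lcs k}"
      using subspace_0[OF subspace_lcs] by blast
  qed
  then show ?thesis unfolding gr_def coset_family_def calg.simps
    by (intro restrict_ext) (simp only: restrict_apply')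
qed

lemma vbr_coset_family:
  assumes a: "\<And>k. k \<in> {1..nilindex} \<Longrightarrow> a k \<in> lcs k" and b: "\<And>k. k \<in> {1..nilindex} \<Longrightarrow> b k \<in> lcs k"
  shows "vbr gr (coset_family a) (coset_family b) = coset_family (\<lambda>k. \<Sum>i = 1..<k. br (a i) (b (k - i)))"
proof -
  have "{(\<Sum>i = 1..<k. br (a' i) (b' (k - i))) + w |a' b' w.
           (\<forall>i\<in>{1..<k}. a' i \<in> coset_family a i \<and> b' i \<in> coset_family b i) \<and> w \<in> lcs (Suc k)} =
        (+) (\<Sum>i = 1..<k. br (a i) (b (k - i))) ` lcs (Suc k)" (is "?S = ?C") if k: "k \<in> {1..nilindex}" for k
  proof (intro Set.set_eqI iffI)
    fix z assume "z \<in> ?S"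
    then obtain a' b' w where z: "z = (\<Sum>i = 1..<k. br (a' i) (b' (k - i))) + w" "w \<in> lcs (Suc k)"
      and ab: "\<And>i. i \<in> {1..<k} \<Longrightarrow> a' i \<in> coset_family a i \<and> b' i \<in> coset_family b i" by blast
    \<comment> \<open>Replacing a by a + u and b by b + v changes the bracket by [u, b + v] +
      [a, v], and both terms lie one step deeper than k.\<close>
    have "br (a' i) (b' (k - i)) - br (a i) (b (k - i)) \<in> lcs (Suc k)" if i: "i \<in> {1..<k}" for i
    proof -
      have ki: "k - i \<in> {1..<k}" "i \<in> {1..nilindex}" "k - i \<in> {1..nilindex}" using i k by auto
      obtain u where u: "a' i = a i + u" "u \<in> lcs (Suc i)"
        using ab[OF i] ki by (auto simp: coset_family_def)
      obtain v where v: "b' (k - i) = b (k - i) + v" "v \<in> lcs (Suc (k - i))"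
        using ab[OF ki(1)] ki by (auto simp: coset_family_def)
      have "b (k - i) + v \<in> lcs (k - i)"
        using b[OF ki(3)] v(2) lcs_Suc_subset by (intro subspace_add[OF subspace_lcs]) auto
      then have "br u (b (k - i) + v) \<in> lcs (Suc i + (k - i))"
        using u ki by (intro br_in_lcs_add) auto
      moreover have "br (a i) v \<in> lcs (i + Suc (k - i))"
        using a ki v by (intro br_in_lcs_add) auto
      ultimately have "br u (b (k - i) + v) + br (a i) v \<in> lcs (Suc k)"
        using i by (intro subspace_add[OF subspace_lcs]) auto
      then show ?thesis unfolding u v br_add_left br_add_right by (simp add: algebra_simps)
    qed
    then have "(\<Sum>i = 1..<k. br (a' i) (b' (k - i)) - br (a i) (b (k - i))) \<in> lcs (Suc k)"
      by (intro subspace_sum[OF subspace_lcs])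
    then have "(\<Sum>i = 1..<k. br (a' i) (b' (k - i)) - br (a i) (b (k - i))) + w \<in> lcs (Suc k)"
      using z by (intro subspace_add[OF subspace_lcs])
    moreover have "z = (\<Sum>i = 1..<k. br (a i) (b (k - i))) +
        ((\<Sum>i = 1..<k. br (a' i) (b' (k - i)) - br (a i) (b (k - i))) + w)"
      unfolding z sum_subtractf by simp
    ultimately show "z \<in> ?C" by blast
  next
    fix z assume "z \<in> ?C"
    moreover have "\<forall>i\<in>{1..<k}. a i \<in> coset_family a i \<and> b i \<in> coset_family b i"
      using k subspace_0[OF subspace_lcs] by (force simp: coset_family_def)
    ultimately show "z \<in> ?S" by blast
  qed
  then have "(\<lambda>k\<in>{1..nilindex}. {(\<Sum>i = 1..<k. br (a' i) (b' (k - i))) + w |a' b' w.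
           (\<forall>i\<in>{1..<k}. a' i \<in> coset_family a i \<and> b' i \<in> coset_family b i) \<and> w \<in> lcs (Suc k)}) =
        (\<lambda>k\<in>{1..nilindex}. (+) (\<Sum>i = 1..<k. br (a i) (b (k - i))) ` lcs (Suc k))"
    by (intro restrict_ext)
  then show ?thesis unfolding gr_def coset_family_def[of "\<lambda>k. \<Sum>i = 1..<k. br (a i) (b (k - i))"]
    by (simp only: calg.simps)
qed

text \<open>The sum over \<open>1..<1\<close> is empty, so a product has no component of degree 1.
  This is what lets symbols detect \<open>lcs 2\<close>.\<close>

lemma vbr_gr_closed:
  assumes "F \<in> carrier gr" "G \<in> carrier gr"
  obtains c where "vbr gr F G = coset_family c" "c 1 = 0" "\<And>k. k \<in> {1..nilindex} \<Longrightarrow> c k \<in> lcs k"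
proof -
  obtain a where a: "F = coset_family a" "\<And>k. k \<in> {1..nilindex} \<Longrightarrow> a k \<in> lcs k" by (rule carrier_gr_E[OF assms(1)]) blast
  obtain b where b: "G = coset_family b" "\<And>k. k \<in> {1..nilindex} \<Longrightarrow> b k \<in> lcs k" by (rule carrier_gr_E[OF assms(2)]) blast
  have "(\<Sum>i = 1..<k. br (a i) (b (k - i))) \<in> lcs k" if "k \<in> {1..nilindex}" for k
  proof (intro subspace_sum[OF subspace_lcs])
    fix i assume i: "i \<in> {1..<k}"
    then have "br (a i) (b (k - i)) \<in> lcs (i + (k - i))"
      using that by (intro br_in_lcs_add a(2) b(2)) auto
    then show "br (a i) (b (k - i)) \<in> lcs k" using i by simp
  qed
  then show thesis
    using vbr_coset_family[OF a(2) b(2)] a(1) b(1)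
    by (intro that[of "\<lambda>k. \<Sum>i = 1..<k. br (a i) (b (k - i))"]) auto
qed

text \<open>The class of x in the i-th graded piece. For i beyond \<open>nilindex\<close> it is the
  zero family.\<close>

definition homog :: "nat \<Rightarrow> 'a \<Rightarrow> nat \<Rightarrow> 'a set" where
  "homog i x = coset_family (\<lambda>k. if k = i then x else 0)"

lemma homog_carrier: "x \<in> lcs i \<Longrightarrow> homog i x \<in> carrier gr"
  unfolding homog_def using subspace_0[OF subspace_lcs] by (intro coset_family_carrier) auto

lemma homog_eq_iff: "homog i x = homog i y \<longleftrightarrow> (i \<in> {1..nilindex} \<longrightarrow> x - y \<in> lcs (Suc i))"
  unfolding homog_def coset_family_eq_iff using subspace_0[OF subspace_lcs] by auto

lemma vadd_homog: "vadd gr (homog i x) (homog i y) = homog i (x + y)"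
  unfolding homog_def vadd_coset_family by (intro arg_cong[of _ _ coset_family]) auto

lemma vscale_homog: "vscale gr c (homog i x) = homog i (scale c x)"
  unfolding homog_def vscale_coset_family by (intro arg_cong[of _ _ coset_family]) auto

text \<open>A right factor of degree 1 is the case needed for left-normed words. In the convolution
  sum only j = i contributes, and only in degree i + 1.\<close>

lemma vbr_homog:
  assumes "1 \<le> i" "x \<in> lcs i"
  shows "vbr gr (homog i x) (homog 1 y) = homog (Suc i) (br x y)"
proof -
  have "(\<Sum>j = 1..<k. br (if j = i then x else 0) (if k - j = 1 then y else 0)) =
      (if k = Suc i then br x y else 0)" for k
  proof -
    have "(\<Sum>j = 1..<k. br (if j = i then x else 0) (if k - j = 1 then y else 0)) =
        (\<Sum>j = 1..<k. if j = i then if k = Suc i then br x y else 0 else 0)"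
      by (intro sum.cong) auto
    also have "\<dots> = (if k = Suc i then br x y else 0)" using assms(1) by auto
    finally show ?thesis .
  qed
  moreover have "vbr gr (homog i x) (homog 1 y) =
      coset_family (\<lambda>k. \<Sum>j = 1..<k. br (if j = i then x else 0) (if k - j = 1 then y else 0))"
    unfolding homog_def using assms subspace_0[OF subspace_lcs] by (intro vbr_coset_family) auto
  ultimately show ?thesis by (simp add: homog_def)
qed

section \<open>Gradations of maximum length\<close>

text \<open>One nonzero vector from each nonzero component gives an independent family with as many
  members as the dimension, hence a basis; uniqueness of homogeneous decompositions then makes every
  component a line.\<close>

lemma max_length_gradation_basis:
  assumes "max_length_gradation V"
  obtains k e where "\<forall>i. V i \<noteq> {0} \<longleftrightarrow> i \<in> {k..<k + int (dim UNIV)}"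
    and "\<forall>i. V i \<noteq> {0} \<longrightarrow> e i \<in> V i \<and> e i \<noteq> 0"
    and "\<forall>i. \<forall>x\<in>V i. \<exists>c. x = scale c (e i)"
    and "span (e ` {i. V i \<noteq> {0}}) = UNIV"
proof -
  define D where "D = {i. V i \<noteq> {0}}"
  obtain k t where D: "D = {k..k + int t}" "dim UNIV = t + 1" and grad: "gradation V"
    using assms unfolding max_length_gradation_def connected_gradation_def D_def by blast
  have sub: "subspace (V i)" for i using grad by (simp add: gradation_def)
  have fin: "finite D" by (simp add: D)
  have uniq: "f = g" if "\<And>i. f i \<in> V i" "\<And>i. g i \<in> V i" "sum f D = sum g D" for f g
    using grad that unfolding gradation_def D_def by metis
  have "\<exists>x. x \<in> V i \<and> x \<noteq> 0" if "i \<in> D" for i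
    using that subspace_0[OF sub, of i] unfolding D_def by blast
  then obtain e where e: "\<And>i. i \<in> D \<Longrightarrow> e i \<in> V i \<and> e i \<noteq> 0" by metis
  \<comment> \<open>The family of all c l e l and the family whose sole entry is x at i have the
    same sum, so they agree at i.\<close>
  have comb: "scale (c i) (e i) = x" if "i \<in> D" "x \<in> V i" "(\<Sum>l\<in>D. scale (c l) (e l)) = x" for c i x
  proof -
    let ?f = "\<lambda>l. if l \<in> D then scale (c l) (e l) else 0" and ?g = "\<lambda>l. if l = i then x else 0"
    have "?f = ?g"
    proof (rule uniq)
      show "?f l \<in> V l" "?g l \<in> V l" for l
        using that e subspace_0[OF sub] subspace_scale[OF sub] by auto
      show "sum ?f D = sum ?g D" using that fin by simp
    qed
    from fun_cong[OF this, of i] show ?thesis using that by simp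
  qed
  have inj: "inj_on e D"
  proof
    fix i j assume ij: "i \<in> D" "j \<in> D" "e i = e j"
    have "(\<lambda>l. if l = i then e i else 0) = (\<lambda>l. if l = j then e j else 0)"
      using ij e[OF ij(1)] e[OF ij(2)] subspace_0[OF sub] fin by (intro uniq) auto
    from fun_cong[OF this, of i] show "i = j" using e ij by (auto split: if_splits)
  qed
  have ind: "independent (e ` D)"
  proof (rule independent_if_scalars_zero)
    show "finite (e ` D)" using fin by simp
    fix f x assume s: "(\<Sum>x\<in>e ` D. scale (f x) x) = 0" and x: "x \<in> e ` D"
    then obtain i where i: "i \<in> D" "x = e i" by blast
    have "scale (f (e i)) (e i) = 0"
      using s i subspace_0[OF sub] by (intro comb[where c = "\<lambda>l. f (e l)"]) (simp_all add: sum.reindex[OF inj])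
    then show "f x = 0" using e i by auto
  qed
  have card: "card (e ` D) = dim UNIV" using card_image[OF inj] D by simp
  \<comment> \<open>A finite spanning set is thinned out to a basis, which makes the dimension bound
    for independent sets available.\<close>
  obtain B where B: "finite B" "span B = UNIV" using finite_dim by blast
  obtain B' where B': "B' \<subseteq> B" "independent B'" "B \<subseteq> span B'"
    using maximal_independent_subset[of B] by metis
  have "span B' = UNIV" using span_mono[OF B'(3)] B(2) span_span by auto
  then interpret fd: finite_dimensional_vector_space scale B'
    using B B' finite_subset by unfold_locales auto
  have spn: "span (e ` D) = UNIV"
    using fd.card_ge_dim_independent[OF subset_UNIV ind] card by auto
  show thesis
  proof
    show "\<forall>i. V i \<noteq> {0} \<longleftrightarrow> i \<in> {k..<k + int (dim UNIV)}"
      using D unfolding D_def by (auto simp: set_eq_iff)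
    show "\<forall>i. V i \<noteq> {0} \<longrightarrow> e i \<in> V i \<and> e i \<noteq> 0" using e by (simp add: D_def)
    show "span (e ` {i. V i \<noteq> {0}}) = UNIV" using spn by (simp add: D_def)
    have "\<exists>c. x = scale c (e i)" if x: "x \<in> V i" for i x
    proof (cases "i \<in> D")
      case True
      have "x \<in> span (e ` D)" using spn by simp
      then obtain c where "x = (\<Sum>v\<in>e ` D. scale (c v) v)" using span_finite[of "e ` D"] fin by auto
      then have "scale (c (e i)) (e i) = x"
        using x True by (intro comb[where c = "\<lambda>l. c (e l)"]) (simp_all add: sum.reindex[OF inj])
      then show ?thesis by metis
    next
      case False
      then have "x = scale 0 (e i)" using x by (simp add: D_def)
      then show ?thesis by blast
    qed
    then show "\<forall>i. \<forall>x\<in>V i. \<exists>c. x = scale c (e i)" by blast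
  qed
qed

end

section \<open>Symbols: classes in the graded algebra read in the model\<close>

locale gr_model = leibniz_algebra scale br + antisym_model A N R
  for scale :: "complex \<Rightarrow> 'a::ab_group_add \<Rightarrow> 'a" and br :: "'a \<Rightarrow> 'a \<Rightarrow> 'a"
    and A :: "(idx \<Rightarrow> complex) calg" and N :: nat and R :: "nat set" +
  fixes \<phi> :: "(nat \<Rightarrow> 'a set) \<Rightarrow> idx \<Rightarrow> complex"
  assumes nil: nilpotent
    and bij: "bij_betw \<phi> (carrier gr) (carrier A)"
    and \<phi>_add: "F \<in> carrier gr \<Longrightarrow> G \<in> carrier gr \<Longrightarrow> \<phi> (vadd gr F G) = vadd A (\<phi> F) (\<phi> G)"
    and \<phi>_scale: "F \<in> carrier gr \<Longrightarrow> \<phi> (vscale gr c F) = vscale A c (\<phi> F)"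
    and \<phi>_br: "F \<in> carrier gr \<Longrightarrow> G \<in> carrier gr \<Longrightarrow> \<phi> (vbr gr F G) = vbr A (\<phi> F) (\<phi> G)"
begin

text \<open>The isomorphism \<phi> is not assumed to respect degrees. The arguments therefore follow
  single coordinates of a symbol and not its whole support.\<close>

definition symb :: "nat \<Rightarrow> 'a \<Rightarrow> idx \<Rightarrow> complex" where
  "symb i x = \<phi> (homog i x)"

lemma one_le_nilindex: "1 \<le> nilindex"
  using has_nilindex_nilindex[OF nil] by (simp add: has_nilindex_def)

lemma zero_in_lcs: "0 \<in> lcs i"
  by (rule subspace_0[OF subspace_lcs])

lemma symb_0: "symb i 0 = (\<lambda>z. 0)"
  using \<phi>_scale[OF homog_carrier[OF zero_in_lcs], of 0 i]
  by (simp add: symb_def vscale_homog vscale_model)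

text \<open>This is injectivity of \<phi>. For i beyond \<open>nilindex\<close> both sides hold,
  since \<open>lcs i\<close> is zero there.\<close>

lemma symb_eq_0_iff:
  assumes "1 \<le> i" "x \<in> lcs i"
  shows "symb i x = (\<lambda>z. 0) \<longleftrightarrow> x \<in> lcs (Suc i)"
proof
  assume "symb i x = (\<lambda>z. 0)"
  then have "homog i x = homog i 0"
    using symb_0[of i] assms homog_carrier zero_in_lcs bij
    unfolding symb_def bij_betw_def by (intro inj_onD[of \<phi> "carrier gr"]) auto
  then show "x \<in> lcs (Suc i)"
    using assms lcs_beyond_nilindex[OF nil, of i] zero_in_lcs[of "Suc i"]
    unfolding homog_eq_iff by (cases "i \<le> nilindex") (auto simp del: lcs.simps)
next
  assume "x \<in> lcs (Suc i)"
  then have "homog i x = homog i 0" by (simp add: homog_eq_iff del: lcs.simps)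
  then show "symb i x = (\<lambda>z. 0)" using symb_0[of i] by (simp add: symb_def)
qed

lemma symb_br:
  assumes "1 \<le> i" "x \<in> lcs i"
  shows "symb (Suc i) (br x y) = vbr A (symb i x) (symb 1 y)"
proof -
  have "homog 1 y \<in> carrier gr" by (rule homog_carrier) simp
  then show ?thesis
    unfolding symb_def vbr_homog[OF assms, symmetric] using assms by (intro \<phi>_br homog_carrier) auto
qed

lemma symb_combination:
  "symb 1 (scale c x + scale d y) = (\<lambda>z. c * symb 1 x z + d * symb 1 y z)"
proof -
  have car: "homog 1 w \<in> carrier gr" for w by (rule homog_carrier) simp
  have "symb 1 (scale c x + scale d y) = vadd A (\<phi> (vscale gr c (homog 1 x))) (\<phi> (vscale gr d (homog 1 y)))"
    unfolding symb_def vscale_homog \<phi>_add[OF car car, symmetric] vadd_homog ..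
  then show ?thesis unfolding \<phi>_scale[OF car] vscale_model vadd_model symb_def .
qed

text \<open>In the model the symbol is a sum of two brackets. Pulled back to \<open>gr\<close>,
  these have no component of degree 1, whereas the component of \<open>homog 1 w\<close> there is
  the class of w.\<close>

lemma in_lcs_2:
  assumes "symb 1 w (X 0) = 0" "symb 1 w (X 1) = 0"
  shows "w \<in> lcs 2"
proof -
  have car: "homog 1 w \<in> carrier gr" by (rule homog_carrier) simp
  then have "symb 1 w \<in> carrier A" using bij by (auto simp: symb_def bij_betw_def)
  from derived_model[OF this assms] obtain s t s' t' where st: "s \<in> carrier A" "t \<in> carrier A" "s' \<in> carrier A" "t' \<in> carrier A"
    "symb 1 w = vadd A (vbr A s t) (vbr A s' t')" by blast
  have pre: "\<exists>F\<in>carrier gr. u = \<phi> F" if "u \<in> carrier A" for u using bij that by (auto simp: bij_betw_def)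
  obtain S T S' T' where ST: "S \<in> carrier gr" "T \<in> carrier gr" "S' \<in> carrier gr" "T' \<in> carrier gr"
    "s = \<phi> S" "t = \<phi> T" "s' = \<phi> S'" "t' = \<phi> T'" using pre st(1-4) by metis
  obtain c where c: "vbr gr S T = coset_family c" "c 1 = 0" "\<And>k. k \<in> {1..nilindex} \<Longrightarrow> c k \<in> lcs k"
    using vbr_gr_closed[OF ST(1,2)] by metis
  obtain c' where c': "vbr gr S' T' = coset_family c'" "c' 1 = 0" "\<And>k. k \<in> {1..nilindex} \<Longrightarrow> c' k \<in> lcs k"
    using vbr_gr_closed[OF ST(3,4)] by metis
  have "symb 1 w = vadd A (\<phi> (coset_family c)) (\<phi> (coset_family c'))"
    unfolding st ST(5-) using \<phi>_br ST c(1) c'(1) by metis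
  also have "\<dots> = \<phi> (vadd gr (coset_family c) (coset_family c'))"
    using c c' by (intro \<phi>_add[symmetric] coset_family_carrier) auto
  also have "\<dots> = \<phi> (coset_family (\<lambda>k. c k + c' k))" by (simp add: vadd_coset_family)
  finally have "homog 1 w = coset_family (\<lambda>k. c k + c' k)"
    unfolding symb_def using c c' car bij subspace_add[OF subspace_lcs]
    by (intro inj_onD[of \<phi> "carrier gr"] coset_family_carrier) (auto simp: bij_betw_def)
  then have "w - (c 1 + c' 1) \<in> lcs (Suc 1)"
    unfolding homog_def coset_family_eq_iff using one_le_nilindex by (force simp del: lcs.simps)
  then show ?thesis using c c' by (simp add: numeral_2_eq_2 del: lcs.simps)
qed

text \<open>If the determinant vanished, some nontrivial combination of x and y would have a symbol
  without X 0 and X 1, and \<open>in_lcs_2\<close> would put it into \<open>lcs 2\<close>.\<close>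

lemma symb_det_nonzero:
  assumes indep: "\<And>c d. scale c x + scale d y \<in> lcs 2 \<Longrightarrow> c = 0 \<and> d = 0"
  shows "symb 1 x (X 0) * symb 1 y (X 1) \<noteq> symb 1 x (X 1) * symb 1 y (X 0)"
proof
  assume det: "symb 1 x (X 0) * symb 1 y (X 1) = symb 1 x (X 1) * symb 1 y (X 0)"
  have *: "c = 0 \<and> d = 0"
    if "c * symb 1 x (X 0) + d * symb 1 y (X 0) = 0" "c * symb 1 x (X 1) + d * symb 1 y (X 1) = 0" for c d
    using that by (intro indep in_lcs_2) (simp_all add: symb_combination del: One_nat_def)
  \<comment> \<open>The coefficients are those of a kernel vector of the 2 by 2 matrix: first from
    the X 0 row, and once that row is zero, from the X 1 row.\<close>
  have 0: "symb 1 y (X 0) = 0 \<and> - symb 1 x (X 0) = 0"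
    by (rule *) (use det in \<open>simp_all add: algebra_simps\<close>)
  have "symb 1 y (X 1) = 0 \<and> - symb 1 x (X 1) = 0"
    by (rule *) (use 0 in simp_all)
  then show False using *[of 1 0] 0 by simp
qed

lemma br_not_trivial: "\<exists>x y. br x y \<noteq> 0"
proof (rule ccontr)
  assume "\<not> ?thesis"
  then have "lcs 2 \<subseteq> {0}"
    unfolding numeral_2_eq_2 lcs.simps by (intro span_minimal) auto
  then have lcs: "lcs k = {0}" if "2 \<le> k" for k
    using lcs_antimono[OF that] zero_in_lcs[of k] by auto
  obtain u v where uv: "u \<in> carrier A" "v \<in> carrier A" "vbr A u v \<noteq> (\<lambda>z. 0)" using vbr_nonzero by blast
  obtain S T where ST: "S \<in> carrier gr" "T \<in> carrier gr" "u = \<phi> S" "v = \<phi> T"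
    using uv(1,2) bij_betw_imp_surj_on[OF bij] by blast
  obtain c where c: "vbr gr S T = coset_family c" "c 1 = 0" "\<And>k. k \<in> {1..nilindex} \<Longrightarrow> c k \<in> lcs k"
    using vbr_gr_closed[OF ST(1,2)] by metis
  have "c k = 0" if "k \<in> {1..nilindex}" for k
    using c(2) c(3)[OF that] lcs[of k] that by (cases "k = 1") auto
  then have "vbr gr S T = homog 1 0"
    unfolding c(1) homog_def coset_family_eq_iff using zero_in_lcs by (auto simp del: lcs.simps)
  then have "vbr A u v = symb 1 0" using ST \<phi>_br[OF ST(1,2)] by (simp add: symb_def)
  then show False using uv symb_0 by simp
qed

text \<open>A Leibniz square need not vanish, but the model is antisymmetric, so its class modulo
  \<open>lcs 3\<close> does.\<close>

lemma br_self_in_lcs_3: "br x x \<in> lcs 3"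
proof -
  have "symb 2 (br x x) = (\<lambda>z. 0)" using symb_br[of 1 x x] vbr_self by (simp add: numeral_2_eq_2)
  then show ?thesis using symb_eq_0_iff[of 2 "br x x"] br_in_lcs_Suc[of 1 x x]
    by (simp add: numeral_2_eq_2 numeral_3_eq_3 del: lcs.simps(3))
qed

text \<open>If x generated everything modulo \<open>lcs 2\<close>, each bracket would be a multiple
  of [x,x] modulo \<open>lcs 3\<close>, so \<open>lcs 2\<close> would equal \<open>lcs 3\<close> and
  vanish by nilpotency, against \<open>br_not_trivial\<close>.\<close>

lemma span_insert_lcs_2: "span (insert x (lcs 2)) \<noteq> UNIV"
proof
  assume U: "span (insert x (lcs 2)) = UNIV"
  have dec: "\<exists>c l. y = scale c x + l \<and> l \<in> lcs 2" for y
  proof -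
    have "y \<in> span (insert x (lcs 2))" using U by simp
    then obtain c where "y - scale c x \<in> span (lcs 2)" using span_breakdown_eq by blast
    then have "y - scale c x \<in> lcs 2" using span_eq_iff subspace_lcs by metis
    then show ?thesis by (intro exI[of _ c] exI[of _ "y - scale c x"]) simp
  qed
  have "br y z \<in> lcs 3" for y z
  proof -
    obtain c l where y: "y = scale c x + l" "l \<in> lcs 2" using dec by blast
    obtain d l' where z: "z = scale d x + l'" "l' \<in> lcs 2" using dec by blast
    have "br l w \<in> lcs 3" for w using br_in_lcs_Suc[OF _ y(2)] by (simp add: numeral_3_eq_3 numeral_2_eq_2 del: lcs.simps)
    moreover have "br w l' \<in> lcs 3" for w
    proof -
      have "w \<in> lcs 1" by simp
      then have "br w l' \<in> lcs (1 + 2)" using z(2) by (intro br_in_lcs_add) auto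
      then show ?thesis by (simp only: one_plus_numeral num.simps add_num_simps)
    qed
    moreover have "br y z = scale c (scale d (br x x)) + (scale c (br x l') + br l z)"
      unfolding y(1) z(1) by (simp add: br_add_left br_add_right br_scale_left br_scale_right scale_right_distrib add_ac)
    ultimately show ?thesis using br_self_in_lcs_3
      by (metis subspace_add subspace_scale subspace_lcs)
  qed
  then have "lcs 2 \<subseteq> lcs 3"
    using span_minimal[OF _ subspace_lcs, of "{br x y |x y. x \<in> lcs 1}" 3] by (auto simp: numeral_2_eq_2)
  then have "lcs 3 = lcs 2" using lcs_Suc_subset[of 2] by auto
  then have "lcs 2 = {0}" using nil by (intro lcs_stable_eq_0) auto
  then show False using br_not_trivial br_in_lcs_Suc[of 1] by (auto simp: numeral_2_eq_2 simp del: lcs.simps(3))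
qed

section \<open>Leading coordinates of words and the contradiction\<close>

definition leads :: "nat \<Rightarrow> 'a \<Rightarrow> bool" where
  "leads i x \<longleftrightarrow> x \<in> lcs i \<and> (\<forall>l<i. symb i x (X l) = 0) \<and> symb i x (X i) \<noteq> 0"

text \<open>As the symbol of x vanishes at X 0, \<open>vbr_X\<close> says that bracketing with y
  shifts the coordinates from X 1 on by one index and multiplies them by
  \<open>- symb 1 y (X 0)\<close>.\<close>

lemma leads_br:
  assumes "leads i x" "1 \<le> i" "i < N" "symb 1 y (X 0) \<noteq> 0"
  shows "leads (Suc i) (br x y)"
proof -
  have x: "x \<in> lcs i" "\<And>l. l < i \<Longrightarrow> symb i x (X l) = 0" "symb i x (X i) \<noteq> 0"
    using assms(1) by (auto simp: leads_def)
  have "symb (Suc i) (br x y) (X l) = 0" if "l < Suc i" for l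
  proof -
    consider "l = 0" | "l = 1" | k where "l = Suc k" "1 \<le> k" "k < i"
      using \<open>l < Suc i\<close> by (cases l) force+
    then show ?thesis
      using x(2)[of 0] x(2) vbr_X assms(2,3) unfolding symb_br[OF assms(2) x(1)]
      by cases (auto simp: vbr_X0 vbr_X1[simplified])
  qed
  moreover have "symb (Suc i) (br x y) (X (Suc i)) \<noteq> 0"
    using x(2)[of 0] x(3) assms unfolding symb_br[OF assms(2) x(1)] by (simp add: vbr_X)
  ultimately show ?thesis
    unfolding leads_def using br_in_lcs_Suc[OF assms(2) x(1)] by blast
qed

lemma leads_not_in_lcs_Suc: "1 \<le> i \<Longrightarrow> leads i x \<Longrightarrow> x \<notin> lcs (Suc i)"
  using symb_eq_0_iff[of i x] by (auto simp: leads_def simp del: lcs.simps)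

lemma no_max_length_gradation:
  assumes dim: "dim UNIV = N + 1 + card R" and fin: "finite R" and N: "8 \<le> N"
    and R3: "3 \<le> card R" and R2: "2 * card R \<le> N + 2"
    and R: "\<And>\<rho>. \<rho> \<in> R \<Longrightarrow> odd \<rho> \<and> 3 \<le> \<rho> \<and> \<rho> \<le> Suc N"
  shows "\<not> max_length_gradation V"
proof
  assume V: "max_length_gradation V"
  then have Vbr: "x \<in> V i \<Longrightarrow> y \<in> V j \<Longrightarrow> br x y \<in> V (i + j)" for i j x y
    by (simp add: max_length_gradation_def connected_gradation_def gradation_def)
  obtain k e where k: "\<forall>i. V i \<noteq> {0} \<longleftrightarrow> i \<in> {k..<k + int (N + 1 + card R)}"
    and e: "\<forall>i. V i \<noteq> {0} \<longrightarrow> e i \<in> V i \<and> e i \<noteq> 0"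
    and line: "\<forall>i. \<forall>x\<in>V i. \<exists>c. x = scale c (e i)"
    and spn: "span (e ` {i. V i \<noteq> {0}}) = UNIV"
    by (rule max_length_gradation_basis[OF V, unfolded dim])
  define H where "H d i \<longleftrightarrow> 1 \<le> i \<and> (\<exists>x\<in>V d. x \<in> lcs i \<and> x \<notin> lcs (Suc i))" for d i
  have H_range: "d \<in> {k..<k + int (N + 1 + card R)}" if "H d i" for d i
    using that zero_in_lcs[of "Suc i"] unfolding H_def k[rule_format, symmetric] by auto
  \<comment> \<open>Since V d is a line, x is a multiple of the deeper element y and hence just as
    deep.\<close>
  have H_le: "l \<le> i" if "H d i" "H d l" for d i l
  proof (rule ccontr)
    assume "\<not> l \<le> i"
    obtain x y where x: "x \<in> V d" "x \<notin> lcs (Suc i)" and y: "y \<in> V d" "y \<in> lcs l" "y \<notin> lcs (Suc l)"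
      using \<open>H d i\<close> \<open>H d l\<close> unfolding H_def by blast
    obtain c c' where c: "x = scale c (e d)" "y = scale c' (e d)" using line x(1) y(1) by metis
    have "c' \<noteq> 0" using c y(3) zero_in_lcs[of "Suc l"] by auto
    then have "x = scale (c / c') y" using c by simp
    then have "x \<in> lcs l" using y(2) subspace_scale[OF subspace_lcs] by simp
    then show False using x(2) lcs_antimono[of "Suc i" l] \<open>\<not> l \<le> i\<close> by auto
  qed
  then have H_fun: "i = l" if "H d i" "H d l" for d i l using that by (meson le_antisym)
  have H_leads: "H d i" if "1 \<le> i" "x \<in> V d" "leads i x" for d i x
    using that leads_not_in_lcs_Suc[of i x] unfolding H_def leads_def by blast

  \<comment> \<open>Homogeneous vectors span everything, while \<open>lcs 2\<close> enlarged by one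
    vector does not. Applied twice, this finds two homogeneous vectors independent modulo
    \<open>lcs 2\<close>.\<close>
  have outside: "\<exists>i. V i \<noteq> {0} \<and> e i \<notin> span (insert x (lcs 2))" for x
  proof (rule ccontr)
    assume "\<not> ?thesis"
    then have "span (e ` {i. V i \<noteq> {0}}) \<subseteq> span (insert x (lcs 2))"
      by (intro span_minimal) auto
    then show False using spn span_insert_lcs_2 by auto
  qed
  obtain a where a: "V a \<noteq> {0}" "e a \<notin> span (insert 0 (lcs 2))" using outside by blast
  obtain b where b: "V b \<noteq> {0}" "e b \<notin> span (insert (e a) (lcs 2))" using outside by blast
  have ab: "a \<noteq> b" using b span_base[of "e a" "insert (e a) (lcs 2)"] by auto
  have eV: "e a \<in> V a" "e b \<in> V b" using e a b by auto
  have ea2: "e a \<notin> lcs 2" using a span_base[of "e a" "insert 0 (lcs 2)"] by auto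
  have eb2: "e b \<notin> lcs 2" using b span_base[of "e b" "insert (e a) (lcs 2)"] by auto
  have Hab: "H a 1" "H b 1" using eV ea2 eb2 unfolding H_def by (auto simp: numeral_2_eq_2 simp del: lcs.simps(3))
  have indep: "c = 0 \<and> d = 0" if cd: "scale c (e a) + scale d (e b) \<in> lcs 2" for c d
  proof -
    have d: "d = 0"
    proof (rule ccontr)
      assume "d \<noteq> 0"
      then have "e b = scale (1 / d) ((scale c (e a) + scale d (e b)) - scale c (e a))"
        by (simp add: scale_right_diff_distrib)
      also have "\<dots> \<in> span (insert (e a) (lcs 2))"
        using cd by (intro span_scale span_diff) (auto intro: span_base span_scale)
      finally show False using b by simp
    qed
    have "c = 0"
    proof (rule ccontr)
      assume "c \<noteq> 0"
      then have "e a = scale (1 / c) (scale c (e a) + scale d (e b))" using d by simp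
      also have "\<dots> \<in> lcs 2" using cd by (rule subspace_scale[OF subspace_lcs])
      finally show False using ea2 by simp
    qed
    then show ?thesis using d by simp
  qed
  have det: "symb 1 (e a) (X 0) * symb 1 (e b) (X 1) \<noteq> symb 1 (e a) (X 1) * symb 1 (e b) (X 0)"
    by (rule symb_det_nonzero) (rule indep)

  \<comment> \<open>Here y starts the words and x prolongs them: [y,x,...,x] with i letters x has
    degree d + i c and depth i + 1. One more bracket with y, at length \<rho> - 1, gives the
    remaining degrees.\<close>
  have one_sided: False
    if x: "x \<in> V c" "H c 1" "symb 1 x (X 0) \<noteq> 0" and y: "y \<in> V d" "symb 1 y (X 0) = 0" "symb 1 y (X 1) \<noteq> 0"
      and cd: "c \<noteq> d" for x y c d
  proof -
    have word: "\<exists>w\<in>V (d + int i * c). leads (Suc i) w" if "i < N" for i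
      using that
    proof (induction i)
      case 0
      then show ?case using y by (auto simp: leads_def)
    next
      case (Suc i)
      then obtain w where w: "w \<in> V (d + int i * c)" "leads (Suc i) w" by auto
      then have "leads (Suc (Suc i)) (br w x)" using Suc.prems x by (intro leads_br) auto
      moreover have "br w x \<in> V (d + int (Suc i) * c)" using Vbr[OF w(1) x(1)] by (simp add: algebra_simps)
      ultimately show ?case by blast
    qed
    show False
    proof (rule no_level_function[where H = H and k = k, OF fin N R3 R2 _ H_range H_fun cd x(2)])
      show "H (d + int i * c) (Suc i)" if "i < N" for i using word[OF that] H_leads by auto
      show "H (2 * d + (int \<rho> - 2) * c) \<rho>" if \<rho>: "\<rho> \<in> R" for \<rho>
      proof -
        \<comment> \<open>The bound \<rho> <= N + 1 ensures that the word with \<rho> - 2 letters x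
          is among those constructed.\<close>
        have "\<rho> - 2 < N" using R[OF \<rho>] N by linarith
        then obtain w where w: "w \<in> V (d + int (\<rho> - 2) * c)" "leads (Suc (\<rho> - 2)) w"
          using word by blast
        have \<rho>1: "Suc (\<rho> - 2) = \<rho> - 1" "Suc (\<rho> - 1) = \<rho>" "1 \<le> \<rho> - 1" using R[OF \<rho>] by auto
        have w': "w \<in> lcs (\<rho> - 1)" "\<And>l. l < \<rho> - 1 \<Longrightarrow> symb (\<rho> - 1) w (X l) = 0" "symb (\<rho> - 1) w (X (\<rho> - 1)) \<noteq> 0"
          using w(2) unfolding \<rho>1 leads_def by auto
        have "vbr A (symb (\<rho> - 1) w) (symb 1 y) \<noteq> (\<lambda>z. 0)"
          using w' y by (intro vbr_R[OF \<rho>]) auto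
        then have "symb \<rho> (br w y) \<noteq> (\<lambda>z. 0)" using symb_br[OF \<rho>1(3) w'(1), of y] \<rho>1(2) by simp
        moreover have "br w y \<in> lcs \<rho>" using br_in_lcs_Suc[OF \<rho>1(3) w'(1)] \<rho>1(2) by simp
        moreover have "br w y \<in> V (2 * d + (int \<rho> - 2) * c)"
          using Vbr[OF w(1) y(1)] R[OF \<rho>] by (simp add: algebra_simps of_nat_diff)
        ultimately show ?thesis using symb_eq_0_iff[of \<rho> "br w y"] R[OF \<rho>] unfolding H_def by auto
      qed
    qed (use R in auto)
  qed

  have "\<not> (symb 1 (e a) (X 0) \<noteq> 0 \<and> symb 1 (e b) (X 0) \<noteq> 0)"
  proof
    assume ne: "symb 1 (e a) (X 0) \<noteq> 0 \<and> symb 1 (e b) (X 0) \<noteq> 0"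
    \<comment> \<open>Up to sign, the coordinate X 2 of this symbol is the determinant
      \<open>det\<close>. After these two letters either generator may follow: first s more letters
      \<open>e a\<close>, then t more letters \<open>e b\<close>.\<close>
    have "symb 2 (br (e b) (e a)) = vbr A (symb 1 (e b)) (symb 1 (e a))"
      using symb_br[of 1 "e b" "e a"] by (simp add: numeral_2_eq_2)
    then have start: "leads 2 (br (e b) (e a))"
      using det N br_in_lcs_Suc[of 1 "e b" "e a"] vbr_X[of 1 "symb 1 (e b)" "symb 1 (e a)"]
      unfolding leads_def
      by (auto simp: vbr_X0 vbr_X1[simplified] numeral_2_eq_2 less_Suc_eq mult.commute simp del: lcs.simps(3))
    have words: "\<exists>w\<in>V (int (s + 1) * a + b). leads (s + 2) w" if "s + 2 \<le> N" for s
      using that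
    proof (induction s)
      case 0
      show ?case using start Vbr[OF eV(2) eV(1)] by (auto simp: add.commute numeral_2_eq_2)
    next
      case (Suc s)
      then obtain w where w: "w \<in> V (int (s + 1) * a + b)" "leads (s + 2) w" by auto
      then have "leads (Suc (s + 2)) (br w (e a))" using Suc.prems ne by (intro leads_br) auto
      moreover have "br w (e a) \<in> V (int (Suc s + 1) * a + b)"
        using Vbr[OF w(1) eV(1)] by (simp add: algebra_simps)
      ultimately show ?case by auto
    qed
    have wordst: "\<exists>w\<in>V (int (s + 1) * a + int (t + 1) * b). leads (s + t + 2) w" if "s + t + 2 \<le> N" for s t
      using that
    proof (induction t)
      case 0
      then show ?case using words[of s] by simp
    next
      case (Suc t)
      then obtain w where w: "w \<in> V (int (s + 1) * a + int (t + 1) * b)" "leads (s + t + 2) w" by auto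
      then have "leads (Suc (s + t + 2)) (br w (e b))" using Suc.prems ne by (intro leads_br) auto
      moreover have "br w (e b) \<in> V (int (s + 1) * a + int (Suc t + 1) * b)"
        using Vbr[OF w(1) eV(2)] by (simp add: algebra_simps)
      ultimately show ?case by auto
    qed
    show False
    proof (rule no_two_parameter_levels[where H = H and k = k, OF N _ H_range H_fun ab])
      show "H (int (s + 1) * a + int (t + 1) * b) (s + t + 2)" if "s + t + 2 \<le> N" for s t
        using wordst[OF that] H_leads[of "s + t + 2"] by auto
    qed (use R2 in simp)
  qed
  \<comment> \<open>When one symbol vanishes at X 0, \<open>det\<close> makes it nonzero at X 1 and
    the other one nonzero at X 0, as \<open>one_sided\<close> requires.\<close>
  then consider "symb 1 (e a) (X 0) = 0" | "symb 1 (e b) (X 0) = 0" by blast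
  then show False
  proof cases
    case 1
    then show False using one_sided[OF eV(2) Hab(2) _ eV(1)] det ab by auto
  next
    case 2
    then show False using one_sided[OF eV(1) Hab(1) _ eV(2)] det ab by auto
  qed
qed

end

section \<open>The cases L and Q\<close>

theorem theorem3p1:
  fixes scale :: "complex \<Rightarrow> 'a::ab_group_add \<Rightarrow> 'a"
    and br :: "'a \<Rightarrow> 'a \<Rightarrow> 'a"
    and n p :: nat and r :: "nat \<Rightarrow> nat"
  assumes "4 \<le> p"
    and "max (3 * p - 1) (p + 8) \<le> n"
    and "\<forall>j\<in>{1..p - 1}. odd (r j) \<and> 3 \<le> r j \<and> r j \<le> n - p"
    and "strict_mono_on {1..p - 1} r"
    and "leibniz_algebra scale br"
    and "vector_space.dim scale (UNIV :: 'a set) = n"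
    and "leibniz_algebra.non_split scale br"
    and "leibniz_algebra.p_filiform scale br p"
    and "calg_isomorphic (leibniz_algebra.gr scale br) (L_algebra n p r) \<or>
         (odd (n - p) \<and> r (p - 1) \<le> n - p - 2 \<and>
          calg_isomorphic (leibniz_algebra.gr scale br) (Q_algebra n p r))"
  shows "\<not> (\<exists>V. leibniz_algebra.max_length_gradation scale br V)"
proof -
  interpret leibniz_algebra scale br by fact
  have nil: nilpotent using assms(8) by (simp add: p_filiform_def)
  have inj: "inj_on r {1..p - 1}" by (rule strict_mono_on_imp_inj_on[OF assms(4)])
  \<comment> \<open>The first bound restates p + 8 <= n and the second 3p - 1 <= n.\<close>
  have np: "8 \<le> n - p" "2 * p \<le> n - p + 1" "n = n - p + p" using assms(1,2) by auto
  have conclude: "\<not> max_length_gradation V"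
    if model: "antisym_model A N R" and iso: "calg_isomorphic gr A"
      and "finite R" "8 \<le> N" "n = N + 1 + card R" "3 \<le> card R" "2 * card R \<le> N + 2"
      and "\<And>\<rho>. \<rho> \<in> R \<Longrightarrow> odd \<rho> \<and> 3 \<le> \<rho> \<and> \<rho> \<le> Suc N" for A N R V
  proof -
    interpret antisym_model A N R by (rule model)
    obtain \<phi> where "bij_betw \<phi> (carrier gr) (carrier A)"
      "\<forall>u\<in>carrier gr. \<forall>v\<in>carrier gr. \<phi> (vadd gr u v) = vadd A (\<phi> u) (\<phi> v)"
      "\<forall>c. \<forall>u\<in>carrier gr. \<phi> (vscale gr c u) = vscale A c (\<phi> u)"
      "\<forall>u\<in>carrier gr. \<forall>v\<in>carrier gr. \<phi> (vbr gr u v) = vbr A (\<phi> u) (\<phi> v)"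
      using iso unfolding calg_isomorphic_def by blast
    then interpret gr_model scale br A N R \<phi> using nil by unfold_locales auto
    show ?thesis using that(3-) assms(6) by (intro no_max_length_gradation) auto
  qed
  let ?R = "r ` {1..p - 1}"
  have cR: "card ?R = p - 1" using card_image[OF inj] by simp
  from assms(9) show ?thesis
  proof
    assume iso: "calg_isomorphic gr (L_algebra n p r)"
    have "antisym_model (L_algebra n p r) (n - p) ?R"
      using table_algebra_model[of "L_table n p r" n p r False, OF L_table_not_X] assms(1,3) np inj
      by (simp add: L_algebra_def)
    then have "\<not> max_length_gradation V" for V
    proof (rule conclude[OF _ iso])
      show "odd \<rho> \<and> 3 \<le> \<rho> \<and> \<rho> \<le> Suc (n - p)" if "\<rho> \<in> ?R" for \<rho>
        using assms(3) that by auto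
    qed (use np assms(1) cR in auto)
    then show ?thesis by blast
  next
    assume Q: "odd (n - p) \<and> r (p - 1) \<le> n - p - 2 \<and> calg_isomorphic gr (Q_algebra n p r)"
    have rle: "r j \<le> n - p - 2" if "j \<in> {1..p - 1}" for j
      using strict_mono_on_leD[OF assms(4) that, of "p - 1"] that Q by auto
    have "antisym_model (Q_algebra n p r) (n - p - 1) (?R \<union> {n - p})"
      using table_algebra_model[of "Q_table n p r" n p r True, OF Q_table_not_X] assms(1,3) np inj rle
      by (simp add: Q_algebra_def table_form_Q)
    then have "\<not> max_length_gradation V" for V
    proof (rule conclude)
      show "calg_isomorphic gr (Q_algebra n p r)" using Q by blast
      \<comment> \<open>Here N is n - p - 1; oddness of n - p improves n - p >= 8 to n - p >= 9 and
        so restores N >= 8.\<close>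
      have "n - p \<noteq> 8" using Q by (metis even_numeral)
      then show "8 \<le> n - p - 1" using np by linarith
      \<comment> \<open>All r j lie below n - p, so R has p elements, and 2p <= N + 2 is exactly n
        >= 3p - 1.\<close>
      have "n - p \<notin> ?R" using rle np by force
      then have "card (?R \<union> {n - p}) = p" using cR assms(1) by simp
      then show "n = n - p - 1 + 1 + card (?R \<union> {n - p})" "3 \<le> card (?R \<union> {n - p})"
        "2 * card (?R \<union> {n - p}) \<le> n - p - 1 + 2" using np assms(1) by linarith+
      show "odd \<rho> \<and> 3 \<le> \<rho> \<and> \<rho> \<le> Suc (n - p - 1)" if "\<rho> \<in> ?R \<union> {n - p}" for \<rho>
        using assms(3) that Q np by auto
    qed simp
    then show ?thesis by blast
  qed
qed

end
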